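(* Let $(\Omega,\sigma)$ be a minimal continuous flow on a compact metric space, let $a,b:\Omega\to\mathbb{R}$ be continuous, and let $g:\Omega\times\mathbb{R}\to\mathbb{R}$ satisfy, for some real numbers $r_1<r_2$: - the partial derivative $g_x$ exists, and $g,g_x$ are continuous on $\Omega\times\mathbb{R}$; - $g(\omega,x)=0$ if $r_1\le x\le r_2$, $g(\omega,x)>0$ if $x<r_1$, and $g(\omega,x)<0$ if $x>r_2$; - $\lim_{x\to\pm\infty}g(\omega,x)/x=-\infty$ uniformly on $\Omega$; - $g_x(\omega,x)<0$ whenever $x\notin[r_1,r_2]$. Let $(\Omega\times\mathbb{R},\tau)$ be the flow induced by the family $x'=a(\omega\cdot t)\,x+b(\omega\cdot t)+g(\omega\cdot t,x)$, $\omega\in\Omega$, let $\mathcal{A}=\bigcup_{\omega\in\Omega}\big(\{\omega\}\times[\alpha_{\mathcal{A}}(\omega),\beta_{\mathcal{A}}(\omega)]\big)$ be its global attractor, and let $\Omega_c\subseteq\Omega$ be the residual set of common continuity points of $\alpha_{\mathcal{A}}$ and $\beta_{\mathcal{A}}$. Assume also that - $\mathcal{A}$ is a pinched set, and the only $\tau$-minimal set $\mathcal{M}$ is contained either in $\Omega\times[r_1,r_2)$ or in $\Omega\times(r_1,r_2]$; - $\sup\Sigma_a=0$ and $a\in\mathcal{R}_m(\Omega)$ for a measure $m\in\mathfrak{M}_{\mathrm{erg}}(\Omega,\sigma)$. Then: (i) $m(\Omega_c)=0$, and the restricted flow $(\mathcal{A},\tau)$ is chain recurrent and Li–Yorke (fiber-)chaotic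 in measure with respect to $m$. More precisely, the $\sigma$-invariant subset $\Omega_{LY}\subseteq\Omega$ of points $\omega$ such that the section $\mathcal{A}_\omega$ is a nondegenerate interval and the set $\{\omega\}\times\mathcal{A}_\omega$ is scrambled satisfies $\Omega_{LY}\subseteq\Omega-\Omega_c$ and $m(\Omega_{LY})=1$. (ii) For every $\varepsilon\in(0,1)$ there exists a subset $\Omega_\varepsilon\subseteq\Omega_{LY}$ with $m(\Omega_\varepsilon)=1$ such that, for any $\omega\in\Omega_\varepsilon$, the set $$\{t\ge0 : |x(t,\omega,x_2)-x(t,\omega,x_1)|\le\varepsilon\,|x_2-x_1|\ \text{ if }(\omega,x_1),(\omega,x_2)\in\mathcal{A}\}$$ has positive lower density and is relatively dense in $\mathbb{R}^+$; and the set $$\{t\ge0 : |x(t,\omega,x_2)-x(t,\omega,x_1)|\ge(1-\varepsilon)\,|x_2-x_1|\ \text{ if }(\omega,x_1),(\omega,x_2)\in\mathcal{A}\}$$ has positive lower density.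
   Context: Write $\omega\cdot t:=\sigma(t,\omega)$. The induced (local) flow is $\tau(t,\omega,x_0)=(\omega\cdot t,x(t,\omega,x_0))$, where $x(t,\omega,x_0)$ is the maximal solution of the equation corresponding to $\omega$ with $x(0,\omega,x_0)=x_0$; $\Omega\times\mathbb{R}$ carries the distance $\mathrm{dist}_\Omega(\omega_1,\omega_2)+|x_1-x_2|$. A set is $\tau$-invariant if it is composed of globally defined orbits and is mapped onto itself by $\tau_t$ for all $t\in\mathbb{R}$. A $\tau$-minimal set is a nonempty compact $\tau$-invariant set with no proper nonempty compact $\tau$-invariant subset ($(\Omega,\sigma)$ minimal: $\Omega$ itself is minimal for $\sigma$). $\mathfrak{M}_{\mathrm{erg}}(\Omega,\sigma)$ is the set of $\sigma$-ergodic Borel probability measures. Sacker–Sell spectrum: the family $x'=c(\omega\cdot t)\,x$, $\omega\in\Omega$ ($c$ continuous) has exponential dichotomy over $\Omega$ if there are $\kappa\ge1$, $\gamma>0$ such that either $\exp\int_0^t c(\omega\cdot l)\,dl\le\kappa e^{-\gamma t}$ for all $\omega\in\Omega$, $t\ge0$, or $\exp\int_0^t c(\omega\cdot l)\,dl\le\kappa e^{\gamma t}$ for all $\omega\in\Omega$, $t\le0$. $\Sigma_a$ is the set of $\lambda\in\mathbb{R}$ such that $x'=(a(\omega\cdot t)-\lambda)\,x$, $\omega\in\Omega$, does not have exponential dichotomy over $\Omega$. (It is known that $\Sigma_a$ is the compact interval with endpoints the infimum and supremum of $\int_\Omega a\,dm$ over the $\sigma$-invariant Borel probability measures $m$.)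 $a$ admits a continuous primitive if there is a continuous $h_a:\Omega\to\mathbb{R}$ with $h_a(\omega\cdot t)-h_a(\omega)=\int_0^t a(\omega\cdot s)\,ds$ for all $\omega,t$. $\mathcal{R}_m(\Omega)$ is the set of continuous $a:\Omega\to\mathbb{R}$ with $\int_\Omega a\,dm=0$ which do not admit a continuous primitive and satisfy $\sup_{t\le0}\int_0^t a(\omega\cdot s)\,ds<\infty$ for $m$-a.e. $\omega\in\Omega$. Background: under the stated conditions all forward semiorbits are globally defined and bounded, and $\tau$ has a global attractor $\mathcal{A}$, i.e. a compact $\tau$-invariant set with $\lim_{t\to\infty}\mathrm{dist}(\tau_t(\mathcal{C}),\mathcal{A})=0$ (Hausdorff semidistance) for every bounded $\mathcal{C}$; it has the displayed form, with $\alpha_{\mathcal{A}}$ lower and $\beta_{\mathcal{A}}$ upper semicontinuous, both $\tau$-equilibria ($\alpha(\omega\cdot t)=x(t,\omega,\alpha(\omega))$ for all $t,\omega$). Sections: $\mathcal{A}_\omega:=\{x : (\omega,x)\in\mathcal{A}\}$. $\mathcal{A}$ is pinched if some section is a singleton; in that case there is exactly one $\tau$-minimal set. Chain recurrence: a flow $(Y,\phi)$ on a compact metric space is chain recurrent if for all $\varepsilon>0$, $T>0$ and $y,\widetilde y\in Y$ there are $k\ge1$, points $y_0=y,\dots,y_k=\widetilde y$ in $Y$ and times $s_0,\dots,s_{k-1}\ge T$ with $\mathrm{dist}(\phi_{s_i}(y_i),y_{i+1})<\varepsilon$ for all $i=0,\dots,k-1$. Li–Yorke chaos: two points $y_1,y_2$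 form a Li–Yorke pair for $\phi$ if $\liminf_{t\to\infty}\mathrm{dist}(\phi_t(y_1),\phi_t(y_2))=0$ and $\limsup_{t\to\infty}\mathrm{dist}(\phi_t(y_1),\phi_t(y_2))>0$; a set is scrambled if every pair of different points of it is a Li–Yorke pair. For a compact $\tau$-invariant $\mathcal{K}\subset\Omega\times\mathbb{R}$, $(\mathcal{K},\tau)$ is Li–Yorke fiber-chaotic in measure with respect to $m$ if there is $\Omega_0\subseteq\Omega$ with $m(\Omega_0)=1$ such that, for each $\omega\in\Omega_0$, $\mathcal{K}$ contains an uncountable scrambled set of points with first component $\omega$. The lower density of $\mathcal{C}\subset[0,\infty)$ is $\liminf_{t\to\infty}\frac1t\,l([0,t]\cap\mathcal{C})$ ($l$ Lebesgue measure). $\mathcal{C}$ is relatively dense in $\mathbb{R}^+$ if there is $L>0$ such that $[s,s+L]\cap\mathcal{C}\neq\emptyset$ for all $s\ge0$. *)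

theory Defs
  imports "HOL-Probability.Probability"
begin

definition continuous_flow :: "(real \<Rightarrow> 'w::metric_space \<Rightarrow> 'w) \<Rightarrow> bool" where
  "continuous_flow \<sigma> \<longleftrightarrow>
     continuous_on UNIV (\<lambda>(t, \<omega>). \<sigma> t \<omega>) \<and>
     (\<forall>\<omega>. \<sigma> 0 \<omega> = \<omega>) \<and> (\<forall>s t \<omega>. \<sigma> (s + t) \<omega> = \<sigma> s (\<sigma> t \<omega>))"

definition minimal_flow :: "(real \<Rightarrow> 'w::metric_space \<Rightarrow> 'w) \<Rightarrow> bool" where
  "minimal_flow \<sigma> \<longleftrightarrow>
     (\<forall>K. compact K \<and> K \<noteq> {} \<and> (\<forall>t. \<sigma> t ` K = K) \<longrightarrow> K = UNIV)"

definition invariant_measure :: "(real \<Rightarrow> 'w::metric_space \<Rightarrow> 'w) \<Rightarrow> 'w measure \<Rightarrow> bool" where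
  "invariant_measure \<sigma> m \<longleftrightarrow>
     sets m = sets borel \<and> prob_space m \<and>
     (\<forall>t. \<forall>B\<in>sets borel. emeasure m (\<sigma> t ` B) = emeasure m B)"

definition ergodic_measure :: "(real \<Rightarrow> 'w::metric_space \<Rightarrow> 'w) \<Rightarrow> 'w measure \<Rightarrow> bool" where
  "ergodic_measure \<sigma> m \<longleftrightarrow>
     invariant_measure \<sigma> m \<and>
     (\<forall>B\<in>sets borel. (\<forall>t. \<sigma> t ` B = B) \<longrightarrow> measure m B = 0 \<or> measure m B = 1)"

text \<open>The interval integral \<open>LBINT s=0..t\<close> is oriented, hence has the intended sign for \<open>t < 0\<close>.\<close>

definition exp_dichotomy :: "(real \<Rightarrow> 'w::metric_space \<Rightarrow> 'w) \<Rightarrow> ('w \<Rightarrow> real) \<Rightarrow> bool" where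
  "exp_dichotomy \<sigma> c \<longleftrightarrow>
     (\<exists>\<kappa>\<ge>1. \<exists>\<gamma>>0.
        (\<forall>\<omega>. \<forall>t\<ge>0. exp (LBINT l=0..ereal t. c (\<sigma> l \<omega>)) \<le> \<kappa> * exp (- \<gamma> * t)) \<or>
        (\<forall>\<omega>. \<forall>t\<le>0. exp (LBINT l=0..ereal t. c (\<sigma> l \<omega>)) \<le> \<kappa> * exp (\<gamma> * t)))"

definition sacker_sell_spectrum :: "(real \<Rightarrow> 'w::metric_space \<Rightarrow> 'w) \<Rightarrow> ('w \<Rightarrow> real) \<Rightarrow> real set" where
  "sacker_sell_spectrum \<sigma> a = {\<mu>. \<not> exp_dichotomy \<sigma> (\<lambda>\<omega>. a \<omega> - \<mu>)}"

definition continuous_primitive :: "(real \<Rightarrow> 'w::metric_space \<Rightarrow> 'w) \<Rightarrow> ('w \<Rightarrow> real) \<Rightarrow> bool" where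
  "continuous_primitive \<sigma> a \<longleftrightarrow>
     (\<exists>h. continuous_on UNIV h \<and> (\<forall>\<omega> t. h (\<sigma> t \<omega>) - h \<omega> = (LBINT s=0..ereal t. a (\<sigma> s \<omega>))))"

definition R_class :: "(real \<Rightarrow> 'w::metric_space \<Rightarrow> 'w) \<Rightarrow> 'w measure \<Rightarrow> ('w \<Rightarrow> real) set" where
  "R_class \<sigma> m = {a. continuous_on UNIV a \<and> (\<integral>\<omega>. a \<omega> \<partial>m) = 0 \<and> \<not> continuous_primitive \<sigma> a \<and>
     (AE \<omega> in m. bdd_above ((\<lambda>t. LBINT s=0..ereal t. a (\<sigma> s \<omega>)) ` {t::real. t \<le> 0}))}"

text \<open>For the family \<open>x' = f (\<sigma> t \<omega>) x\<close>: \<open>u\<close> solves, on the open interval \<open>J\<close> around \<open>0\<close>,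
  the equation of \<open>\<omega>\<close> with initial value \<open>x0\<close> at time \<open>0\<close>.\<close>

definition solves :: "(real \<Rightarrow> 'w::metric_space \<Rightarrow> 'w) \<Rightarrow> ('w \<Rightarrow> real \<Rightarrow> real) \<Rightarrow>
    'w \<Rightarrow> real \<Rightarrow> real set \<Rightarrow> (real \<Rightarrow> real) \<Rightarrow> bool" where
  "solves \<sigma> f \<omega> x0 J u \<longleftrightarrow>
     open J \<and> is_interval J \<and> 0 \<in> J \<and> u 0 = x0 \<and>
     (\<forall>t\<in>J. (u has_real_derivative f (\<sigma> t \<omega>) (u t)) (at t))"

definition max_interval :: "(real \<Rightarrow> 'w::metric_space \<Rightarrow> 'w) \<Rightarrow> ('w \<Rightarrow> real \<Rightarrow> real) \<Rightarrow>
    'w \<Rightarrow> real \<Rightarrow> real set" where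
  "max_interval \<sigma> f \<omega> x0 = \<Union>{J. \<exists>u. solves \<sigma> f \<omega> x0 J u}"

text \<open>The maximal solution \<open>x(t,\<omega>,x0)\<close>. The value is meaningful only for
  \<open>t \<in> max_interval \<sigma> f \<omega> x0\<close> and when solutions are unique (as for \<open>f\<close> of class \<open>C\<^sup>1\<close> in \<open>x\<close>).\<close>

definition msol :: "(real \<Rightarrow> 'w::metric_space \<Rightarrow> 'w) \<Rightarrow> ('w \<Rightarrow> real \<Rightarrow> real) \<Rightarrow>
    real \<Rightarrow> 'w \<Rightarrow> real \<Rightarrow> real" where
  "msol \<sigma> f t \<omega> x0 = (THE v. \<exists>J u. solves \<sigma> f \<omega> x0 J u \<and> t \<in> J \<and> v = u t)"

definition induced_flow :: "(real \<Rightarrow> 'w::metric_space \<Rightarrow> 'w) \<Rightarrow> ('w \<Rightarrow> real \<Rightarrow> real) \<Rightarrow>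
    real \<Rightarrow> 'w \<times> real \<Rightarrow> 'w \<times> real" where
  "induced_flow \<sigma> f t p = (\<sigma> t (fst p), msol \<sigma> f t (fst p) (snd p))"

definition tau_invariant :: "(real \<Rightarrow> 'w::metric_space \<Rightarrow> 'w) \<Rightarrow> ('w \<Rightarrow> real \<Rightarrow> real) \<Rightarrow>
    ('w \<times> real) set \<Rightarrow> bool" where
  "tau_invariant \<sigma> f C \<longleftrightarrow>
     (\<forall>(\<omega>, x0)\<in>C. max_interval \<sigma> f \<omega> x0 = UNIV) \<and> (\<forall>t. induced_flow \<sigma> f t ` C = C)"

definition tau_minimal :: "(real \<Rightarrow> 'w::metric_space \<Rightarrow> 'w) \<Rightarrow> ('w \<Rightarrow> real \<Rightarrow> real) \<Rightarrow>
    ('w \<times> real) set \<Rightarrow> bool" where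
  "tau_minimal \<sigma> f M \<longleftrightarrow>
     M \<noteq> {} \<and> compact M \<and> tau_invariant \<sigma> f M \<and>
     (\<forall>K. K \<noteq> {} \<and> compact K \<and> tau_invariant \<sigma> f K \<and> K \<subseteq> M \<longrightarrow> K = M)"

text \<open>The sum distance on the product; the library's metric on pairs is the (uniformly equivalent)
  Euclidean one.\<close>

definition sdist :: "'w::metric_space \<times> real \<Rightarrow> 'w \<times> real \<Rightarrow> real" where
  "sdist p q = dist (fst p) (fst q) + \<bar>snd p - snd q\<bar>"

definition hausdorff_semidist :: "('w::metric_space \<times> real) set \<Rightarrow> ('w \<times> real) set \<Rightarrow> ennreal" where
  "hausdorff_semidist C A = (SUP p\<in>C. INF q\<in>A. ennreal (sdist p q))"

definition global_attractor :: "(real \<Rightarrow> 'w::metric_space \<Rightarrow> 'w) \<Rightarrow> ('w \<Rightarrow> real \<Rightarrow> real) \<Rightarrow>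
    ('w \<times> real) set \<Rightarrow> bool" where
  "global_attractor \<sigma> f A \<longleftrightarrow>
     compact A \<and> tau_invariant \<sigma> f A \<and>
     (\<forall>C. bounded C \<longrightarrow>
        ((\<lambda>t. hausdorff_semidist (induced_flow \<sigma> f t ` C) A) \<longlongrightarrow> 0) at_top)"

definition fiber :: "('w \<times> real) set \<Rightarrow> 'w \<Rightarrow> real set" where
  "fiber A \<omega> = {x. (\<omega>, x) \<in> A}"

definition pinched :: "('w \<times> real) set \<Rightarrow> bool" where
  "pinched A \<longleftrightarrow> (\<exists>\<omega>. is_singleton (fiber A \<omega>))"

definition chain_recurrent :: "('p \<Rightarrow> 'p \<Rightarrow> real) \<Rightarrow> 'p set \<Rightarrow> (real \<Rightarrow> 'p \<Rightarrow> 'p) \<Rightarrow> bool" where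
  "chain_recurrent d Y \<phi> \<longleftrightarrow>
     (\<forall>\<epsilon>>0. \<forall>T>0. \<forall>y\<in>Y. \<forall>y'\<in>Y. \<exists>k\<ge>1. \<exists>(ys :: nat \<Rightarrow> 'p) (s :: nat \<Rightarrow> real).
        ys 0 = y \<and> ys k = y' \<and> (\<forall>i\<le>k. ys i \<in> Y) \<and>
        (\<forall>i<k. s i \<ge> T \<and> d (\<phi> (s i) (ys i)) (ys (Suc i)) < \<epsilon>))"

definition li_yorke_pair :: "('p \<Rightarrow> 'p \<Rightarrow> real) \<Rightarrow> (real \<Rightarrow> 'p \<Rightarrow> 'p) \<Rightarrow> 'p \<Rightarrow> 'p \<Rightarrow> bool" where
  "li_yorke_pair d \<phi> y1 y2 \<longleftrightarrow>
     Liminf at_top (\<lambda>t. ereal (d (\<phi> t y1) (\<phi> t y2))) = 0 \<and>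
     Limsup at_top (\<lambda>t. ereal (d (\<phi> t y1) (\<phi> t y2))) > 0"

definition scrambled :: "('p \<Rightarrow> 'p \<Rightarrow> real) \<Rightarrow> (real \<Rightarrow> 'p \<Rightarrow> 'p) \<Rightarrow> 'p set \<Rightarrow> bool" where
  "scrambled d \<phi> S \<longleftrightarrow> (\<forall>y1\<in>S. \<forall>y2\<in>S. y1 \<noteq> y2 \<longrightarrow> li_yorke_pair d \<phi> y1 y2)"

definition fiber_chaotic_in_measure :: "(real \<Rightarrow> 'w::metric_space \<times> real \<Rightarrow> 'w \<times> real) \<Rightarrow>
    ('w \<times> real) set \<Rightarrow> 'w measure \<Rightarrow> bool" where
  "fiber_chaotic_in_measure \<tau> K m \<longleftrightarrow>
     (\<exists>\<Omega>0. measure m \<Omega>0 = 1 \<and>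
        (\<forall>\<omega>\<in>\<Omega>0. \<exists>S\<subseteq>K. fst ` S \<subseteq> {\<omega>} \<and> uncountable S \<and> scrambled sdist \<tau> S))"

definition Omega_LY :: "(real \<Rightarrow> 'w::metric_space \<times> real \<Rightarrow> 'w \<times> real) \<Rightarrow> ('w \<times> real) set \<Rightarrow> 'w set" where
  "Omega_LY \<tau> A = {\<omega>. (\<exists>l r. l < r \<and> fiber A \<omega> = {l..r}) \<and> scrambled sdist \<tau> ({\<omega>} \<times> fiber A \<omega>)}"

definition lower_density :: "real set \<Rightarrow> ereal" where
  "lower_density C = Liminf at_top (\<lambda>t. ereal (measure lborel ({0..t} \<inter> C) / t))"

definition relatively_dense :: "real set \<Rightarrow> bool" where
  "relatively_dense C \<longleftrightarrow> (\<exists>L>0. \<forall>s\<ge>0. {s..s + L} \<inter> C \<noteq> {})"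

end

theory Submission
  imports Defs
begin

text \<open>
  Write \<open>I(\<omega>,t)\<close> for the integral of \<open>a\<close> along the orbit of \<open>\<omega>\<close> over \<open>[0,t]\<close>,
  and \<open>d(\<omega>) = \<beta>(\<omega>) - \<alpha>(\<omega>)\<close> for the width of the fiber of the attractor. The function \<open>g\<close> is
  nonincreasing in \<open>x\<close>, so the gap between two solutions over the same \<open>\<omega>\<close>, divided by
  \<open>exp I(\<omega>,t)\<close>, never increases. The whole theorem comes from the fact that for almost every
  \<open>\<omega>\<close> this quotient is constant: on such a fiber the flow is the linear scaling by
  \<open>exp I(\<omega>,t) = d(\<omega>\<cdot>t) / d(\<omega>)\<close>, and the dynamics of pairs is that of the single function \<open>d\<close>.

  Fibers are nondegenerate almost everywhere (\<open>width_pos_if_bounded_primitive\<close>): on the minimal set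
  there is room inside the band \<open>[r1,r2]\<close> on one side, so a small multiple of \<open>exp I(\<omega>,t)\<close> can be
  added to a solution in the minimal set without leaving the band, where the equation is linear. If
  \<open>I(\<omega>,\<cdot>)\<close> is bounded above on the negative half line, this is a second solution bounded in the
  past, and such solutions lie in the attractor.

  The scaling is exact almost everywhere (\<open>AE_width_step\<close>, \<open>conformal_if_width\<close>): the
  difference \<open>ln d(\<omega>\<cdot>1) - ln d(\<omega>)\<close> is at most \<open>I(\<omega>,1)\<close>. The left side is a bounded coboundary and has
  mean zero even though \<open>ln d\<close> need not be integrable; the right side has mean \<open>\<integral> a = 0\<close>. Hence
  they agree almost everywhere. The gaps \<open>[\<alpha>,y]\<close>, \<open>[y,z]\<close>, \<open>[z,\<beta>]\<close> add up to the full
  gap, and since the latter does not lose anything, neither does any of the former.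

  The function \<open>d\<close> is small uniformly often and large with positive frequency. It is upper
  semicontinuous and vanishes somewhere, so \<open>{d < c}\<close> is a nonempty open set, which by minimality and
  compactness every orbit visits within a bounded time (\<open>uniform_return_time\<close>). On the other hand
  almost every point of a Borel set returns to it with positive lower frequency
  (\<open>visits_positive_frequency\<close>), which is applied to the sets \<open>{d \<ge> q}\<close>, \<open>q\<close> rational. The first
  property gives the vanishing limes inferior and the times of contraction, the second the positive
  limes superior and the times of near isometry.

  At a common continuity point of \<open>\<alpha>\<close> and \<open>\<beta>\<close> the width is zero, because the orbit of a pinched
  fiber is dense. Chain recurrence holds since every orbit of the attractor passes close to the pinched
  point both in the future and in the past.
\<close>

section \<open>Measure-preserving maps\<close>

locale measure_preserving_map = prob_space M for M :: "'a measure" +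
  fixes T :: "'a \<Rightarrow> 'a"
  assumes T_measurable [measurable]: "T \<in> measurable M M"
    and distr_T: "distr M M T = M"
begin

lemma integral_compose:
  fixes f :: "'a \<Rightarrow> real"
  assumes "f \<in> borel_measurable M"
  shows "(\<integral>x. f (T x) \<partial>M) = (\<integral>x. f x \<partial>M)"
  using integral_distr[OF T_measurable assms] distr_T by simp

lemma integrable_compose:
  fixes f :: "'a \<Rightarrow> real"
  assumes "integrable M f"
  shows "integrable M (\<lambda>x. f (T x))"
  using integrable_distr_eq[OF T_measurable, of f] assms distr_T by auto

lemma AE_compose:
  assumes "AE x in M. P x"
  shows "AE x in M. P (T x)"
  by (rule AE_distrD[OF T_measurable]) (unfold distr_T, rule assms)

text \<open>
  The transfer function \<open>D\<close> need not be integrable. Clamping it to \<open>[-n,n]\<close> is a contraction, so the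
  coboundaries of the clamped functions keep the bound \<open>K\<close>; they have mean zero by invariance, and
  dominated convergence passes this on to \<open>D\<close>.
\<close>
lemma coboundary_integral_zero:
  fixes D :: "'a \<Rightarrow> real"
  assumes D [measurable]: "D \<in> borel_measurable M"
    and bound: "\<And>x. x \<in> space M \<Longrightarrow> \<bar>D (T x) - D x\<bar> \<le> K"
  shows "(\<integral>x. D (T x) - D x \<partial>M) = 0"
proof -
  define clamp where "clamp n x = max (- real n) (min (real n) (D x))" for n x
  have [measurable]: "clamp n \<in> borel_measurable M" for n
    unfolding clamp_def by measurable
  have int: "integrable M (clamp n)" for n
    by (rule integrable_const_bound[of _ "real n"]) (auto simp: clamp_def)
  have zero: "(\<integral>x. clamp n (T x) - clamp n x \<partial>M) = 0" for n
    using integral_compose[of "clamp n"] int[of n] integrable_compose[OF int[of n]] by simp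
  have "(\<lambda>n. \<integral>x. clamp n (T x) - clamp n x \<partial>M) \<longlonglongrightarrow> (\<integral>x. D (T x) - D x \<partial>M)"
  proof (rule integral_dominated_convergence[where w = "\<lambda>_. K"])
    have "(\<lambda>n. clamp n x) \<longlonglongrightarrow> D x" for x
    proof (rule tendsto_eventually)
      obtain N :: nat where N: "\<bar>D x\<bar> \<le> real N" using real_arch_simple by blast
      show "\<forall>\<^sub>F n in sequentially. clamp n x = D x"
        using eventually_ge_at_top[of N]
        by eventually_elim (use N in \<open>auto simp: clamp_def\<close>)
    qed
    then show "AE x in M. (\<lambda>n. clamp n (T x) - clamp n x) \<longlonglongrightarrow> D (T x) - D x"
      by (intro AE_I2 tendsto_diff) auto
    show "AE x in M. norm (clamp n (T x) - clamp n x) \<le> K" for n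
    proof (rule AE_I2)
      fix x assume "x \<in> space M"
      from bound[OF this] show "norm (clamp n (T x) - clamp n x) \<le> K"
        unfolding clamp_def real_norm_def by linarith
    qed
  qed auto
  then show ?thesis using zero by (simp add: LIMSEQ_const_iff)
qed

text \<open>
  The maximal ergodic inequality in the case that every orbit starting where \<open>f\<close> is nonzero
  has a positive partial sum. The maxima \<open>P n\<close> of the first \<open>n\<close> partial sums satisfy
  \<open>f \<ge> P n - P n \<circ> T\<close> where \<open>P n > 0\<close>, and the right side has mean zero.
\<close>
lemma maximal_ergodic:
  fixes f :: "'a \<Rightarrow> real"
  assumes f: "integrable M f"
    and pos: "\<And>x. x \<in> space M \<Longrightarrow> f x \<noteq> 0 \<Longrightarrow> \<exists>n. 0 < (\<Sum>k<n. f ((T ^^ k) x))"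
  shows "0 \<le> (\<integral>x. f x \<partial>M)"
proof -
  note [measurable] = borel_measurable_integrable[OF f]
  define P where "P = rec_nat (\<lambda>_. 0) (\<lambda>_ p x. max 0 (f x + p (T x)))"
  have P0: "P 0 x = 0" and PS: "P (Suc n) x = max 0 (f x + P n (T x))" for n x
    by (simp_all add: P_def)
  have P_nonneg: "0 \<le> P n x" for n x by (cases n) (auto simp: P0 PS)
  have P_step: "P n x \<le> P (Suc n) x" for n x
  proof (induction n arbitrary: x)
    case (Suc n)
    show ?case unfolding PS[of n x] PS[of "Suc n" x] using Suc[of "T x"] by (intro max.mono) auto
  qed (simp add: P0 PS)
  have P_mono: "n \<le> k \<Longrightarrow> P n x \<le> P k x" for n k x
    by (rule lift_Suc_mono_le[of "\<lambda>n. P n x"]) (auto intro: P_step)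
  have P_int: "integrable M (P n)" for n
  proof (induction n)
    case 0 then show ?case by (simp add: P0[abs_def])
  next
    case (Suc n)
    have "P (Suc n) = (\<lambda>x. max 0 (f x + P n (T x)))" by (auto simp: PS)
    then show ?case using f integrable_compose[OF Suc] by (auto intro!: integrable_max)
  qed
  note [measurable] = borel_measurable_integrable[OF P_int]
  have P_sum: "(\<Sum>k<n. f ((T ^^ k) x)) \<le> P n x" for n x
  proof (induction n arbitrary: x)
    case (Suc n)
    have "(\<Sum>k<Suc n. f ((T ^^ k) x)) = f x + (\<Sum>k<n. f ((T ^^ k) (T x)))"
      by (subst sum.lessThan_Suc_shift) (simp add: funpow_swap1)
    then show ?case using Suc[of "T x"] by (auto simp: PS)
  qed (simp add: P0)
  have key: "P n x - P n (T x) \<le> indicator {y. 0 < P n y} x * f x" for n x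
  proof (cases "0 < P n x")
    case True
    then obtain k where n: "n = Suc k" by (cases n) (auto simp: P0)
    have "P n x = f x + P k (T x)" using True by (auto simp: n PS max_def split: if_splits)
    then show ?thesis using True P_step[of k "T x"] n by simp
  next
    case False
    then show ?thesis using P_nonneg[of n x] P_nonneg[of n "T x"] by simp
  qed
  have ge0: "0 \<le> (\<integral>x. indicator {y. 0 < P n y} x * f x \<partial>M)" for n
  proof -
    have "0 = (\<integral>x. P n x - P n (T x) \<partial>M)"
      using integral_compose[of "P n"] P_int[of n] integrable_compose[OF P_int[of n]] by simp
    also have "\<dots> \<le> (\<integral>x. indicator {y. 0 < P n y} x * f x \<partial>M)"
      using f P_int[of n] integrable_compose[OF P_int[of n]]
      by (intro integral_mono key) (auto intro!: Bochner_Integration.integrable_bound[OF f] simp: indicator_def)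
    finally show ?thesis .
  qed
  have "(\<lambda>n. \<integral>x. indicator {y. 0 < P n y} x * f x \<partial>M) \<longlonglongrightarrow> (\<integral>x. f x \<partial>M)"
  proof (rule integral_dominated_convergence[where w = "\<lambda>x. \<bar>f x\<bar>"])
    show "AE x in M. (\<lambda>n. indicator {y. 0 < P n y} x * f x) \<longlonglongrightarrow> f x"
    proof (rule AE_I2)
      fix x assume x: "x \<in> space M"
      show "(\<lambda>n. indicator {y. 0 < P n y} x * f x) \<longlonglongrightarrow> f x"
      proof (cases "f x = 0")
        case False
        then obtain N where "0 < (\<Sum>k<N. f ((T ^^ k) x))" using pos x by blast
        then have "0 < P N x" using P_sum[of x N] by linarith
        then have "0 < P n x" if "n \<ge> N" for n using P_mono[OF that, of x] by linarith
        then show ?thesis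
          by (intro tendsto_eventually eventually_sequentiallyI[of N]) simp
      qed simp
    qed
  qed (use f in \<open>auto simp: indicator_def\<close>)
  then show ?thesis by (rule LIMSEQ_le_const) (use ge0 in auto)
qed

text \<open>
  A quantitative Poincare recurrence theorem. On the invariant set \<open>E\<close> of points with lower visiting
  frequency zero, the Birkhoff sums of \<open>1/(j+1) - indicator B\<close> become positive at some time, whatever
  \<open>j\<close> is. The maximal ergodic inequality, restricted to \<open>E\<close>, bounds the measure of \<open>B \<inter> E\<close> by
  \<open>1/(j+1)\<close>.
\<close>
lemma visits_positive_frequency:
  assumes B [measurable]: "B \<in> sets M"
  shows "AE x in M. x \<in> B \<longrightarrow>
    (\<exists>c>0. \<exists>n0. \<forall>n\<ge>n0. c * real n \<le> real (card ({k. (T ^^ k) x \<in> B} \<inter> {..<n})))"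
proof -
  define V :: "nat \<Rightarrow> 'a \<Rightarrow> real" where "V n x = (\<Sum>k<n. indicator B ((T ^^ k) x))" for n x
  define E where "E = {x \<in> space M. \<forall>j n0. \<exists>n\<ge>n0. V n x * real (Suc j) < real n}"
  have [measurable]: "(T ^^ k) \<in> measurable M M" for k by (rule measurable_compose_n) simp
  have [measurable]: "V n \<in> borel_measurable M" for n unfolding V_def by measurable
  have E_meas [measurable]: "E \<in> sets M" unfolding E_def by measurable
  have T_space: "T x \<in> space M" if "x \<in> space M" for x
    using that measurable_space[OF T_measurable] by blast
  have V_card: "V n x = real (card ({k. (T ^^ k) x \<in> B} \<inter> {..<n}))" for n x
    unfolding V_def indicator_def of_bool_def by (subst sum.If_cases) (auto simp: Int_commute)
  have V_T: "V (Suc n) x = indicator B x + V n (T x)" for n x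
    unfolding V_def by (subst sum.lessThan_Suc_shift) (simp add: funpow_swap1)
  have E_T: "T x \<in> E" if x: "x \<in> E" for x
  proof -
    have "\<exists>n\<ge>n0. V n (T x) * real (Suc j) < real n" for j n0
    proof -
      \<comment> \<open>Dropping the first visit costs one step; a bound twice as strong, at a later time, leaves room for it.\<close>
      obtain n where n: "n \<ge> n0 + 2" and lt: "V n x * real (Suc (2 * j + 1)) < real n"
        using x unfolding E_def by blast
      then obtain k where k: "n = Suc k" "k \<ge> n0" "k \<ge> 1" by (cases n) auto
      have "V k (T x) * (2 * real (Suc j)) \<le> V n x * (2 * real (Suc j))"
        by (rule mult_right_mono) (auto simp: k V_T)
      also have "\<dots> < real n" using lt by (simp add: algebra_simps)
      also have "\<dots> \<le> 2 * real k" using k by simp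
      finally have "V k (T x) * real (Suc j) < real k" by (simp only: mult.left_commute[of _ 2])
      then show ?thesis using k by blast
    qed
    then show ?thesis using x T_space by (auto simp: E_def)
  qed
  have T_E: "x \<in> E" if x: "x \<in> space M" "T x \<in> E" for x
  proof -
    have "\<exists>n\<ge>n0. V n x * real (Suc j) < real n" for j n0
    proof -
      obtain n where n: "n \<ge> n0 + 2 * Suc j" and lt: "V n (T x) * real (Suc (2 * j + 1)) < real n"
        using x unfolding E_def by blast
      have "2 * (V (Suc n) x * real (Suc j)) \<le> 2 * real (Suc j) + V n (T x) * real (Suc (2 * j + 1))"
        by (simp add: V_T indicator_def algebra_simps)
      also have "\<dots> < real n + real n"
        using lt n by simp
      finally show ?thesis using n by (intro exI[of _ "Suc n"]) simp
    qed
    then show ?thesis using x by (auto simp: E_def)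
  qed
  have E_pow: "x \<in> space M \<Longrightarrow> (T ^^ k) x \<in> E \<longleftrightarrow> x \<in> E" for k x
  proof (induction k arbitrary: x)
    case (Suc k)
    have "(T ^^ Suc k) x = (T ^^ k) (T x)" by (simp add: funpow_swap1)
    then show ?case using Suc.IH[OF T_space[OF Suc.prems]] E_T T_E Suc.prems by auto
  qed simp
  have small: "measure M (B \<inter> E) \<le> 1 / real (Suc j)" for j
  proof -
    define f :: "'a \<Rightarrow> real" where "f x = (1 / real (Suc j) - indicator B x) * indicator E x" for x
    have f_alt: "f = (\<lambda>x. (1 / real (Suc j)) * indicator E x - indicator (B \<inter> E) x)"
      by (auto simp: f_def fun_eq_iff indicator_def)
    have "0 \<le> (\<integral>x. f x \<partial>M)"
    proof (rule maximal_ergodic)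
      show "integrable M f" unfolding f_alt by (auto simp: less_top[symmetric])
      fix x assume x: "x \<in> space M" and "f x \<noteq> 0"
      then have E: "x \<in> E" by (auto simp: f_def indicator_def split: if_splits)
      then obtain n where "V n x * real (Suc j) < real n" by (auto simp: E_def)
      then have "V n x < real n * (1 / real (Suc j))" by (simp add: field_simps)
      moreover have "(\<Sum>k<n. f ((T ^^ k) x)) = real n * (1 / real (Suc j)) - V n x"
        using E_pow[OF x] E by (simp add: f_def V_def sum_subtractf)
      ultimately show "\<exists>n. 0 < (\<Sum>k<n. f ((T ^^ k) x))" by (intro exI[of _ n]) simp
    qed
    also have "(\<integral>x. f x \<partial>M) = 1 / real (Suc j) * measure M E - measure M (B \<inter> E)"
      unfolding f_alt by (subst Bochner_Integration.integral_diff) (auto simp: less_top[symmetric])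
    finally have "measure M (B \<inter> E) \<le> 1 / real (Suc j) * measure M E" by simp
    also have "\<dots> \<le> 1 / real (Suc j) * 1" by (intro mult_left_mono) auto
    finally show ?thesis by simp
  qed
  have "measure M (B \<inter> E) \<le> 0"
    by (rule LIMSEQ_le_const[OF LIMSEQ_inverse_real_of_nat]) (use small in \<open>auto simp: inverse_eq_divide\<close>)
  then have "measure M (B \<inter> E) = 0" using measure_nonneg[of M "B \<inter> E"] by linarith
  then have "B \<inter> E \<in> null_sets M" by (simp add: null_sets_def emeasure_eq_measure)
  then show ?thesis
  proof (rule AE_I')
    show "{x \<in> space M. \<not> (x \<in> B \<longrightarrow>
        (\<exists>c>0. \<exists>n0. \<forall>n\<ge>n0. c * real n \<le> real (card ({k. (T ^^ k) x \<in> B} \<inter> {..<n}))))} \<subseteq> B \<inter> E"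
    proof safe
      fix x assume x: "x \<in> space M" and
        no: "\<nexists>c. c > 0 \<and> (\<exists>n0. \<forall>n\<ge>n0. c * real n \<le> real (card ({k. (T ^^ k) x \<in> B} \<inter> {..<n})))"
      show "x \<in> E" unfolding E_def
      proof (safe intro!: x)
        fix j n0
        have "\<not> (\<forall>n\<ge>n0. (1 / real (Suc j)) * real n \<le> V n x)"
          unfolding V_card by (metis no of_nat_0_less_iff zero_less_Suc zero_less_divide_1_iff)
        then show "\<exists>n\<ge>n0. V n x * real (Suc j) < real n"
          by (auto simp: field_simps not_le)
      qed
    qed
  qed
qed

end

section \<open>Lower density of unions of time blocks\<close>

text \<open>
  Cut the half line into blocks of length \<open>h\<close>. A set that fills at least \<open>\<rho>\<close> of each block whose index
  lies in \<open>J\<close> has lower density at least \<open>\<rho> / h\<close> times that of \<open>J\<close>; half of it is enough here and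
  absorbs the incomplete last block.
\<close>
lemma lower_density_pos_if_blocks:
  assumes C [measurable]: "C \<in> sets borel"
    and pos: "h > 0" "\<rho> > 0" "c > 0"
    and block: "\<And>n. n \<in> J \<Longrightarrow> \<rho> \<le> measure lborel ({real n * h..<real (Suc n) * h} \<inter> C)"
    and freq: "\<And>n. n \<ge> n0 \<Longrightarrow> c * real n \<le> real (card (J \<inter> {..<n}))"
  shows "lower_density C > 0"
proof -
  have "\<forall>\<^sub>F t in at_top. ereal (\<rho> * c / (2 * h)) \<le> ereal (measure lborel ({0..t} \<inter> C) / t)"
    using eventually_ge_at_top[of "2 * h + (real n0 + 1) * h"]
  proof eventually_elim
    case (elim t)
    have t: "t > 0" "t \<ge> 2 * h" "t \<ge> (real n0 + 1) * h"
      using elim pos by (auto simp: add_pos_nonneg intro: less_le_trans[of _ "2 * h + (real n0 + 1) * h"])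
        (smt (verit) mult_nonneg_nonneg of_nat_0_le_iff)+
    define n where "n = nat \<lfloor>t / h\<rfloor>"
    have fl: "real n = of_int \<lfloor>t / h\<rfloor>" using t pos by (simp add: n_def)
    then have n1: "real n \<le> t / h" and n2: "t / h < real n + 1" by linarith+
    have n1': "real n * h \<le> t" using n1 pos by (simp add: field_simps)
    have "real n0 + 1 \<le> t / h" using t pos by (simp add: field_simps)
    then have "n \<ge> n0" using n2 by linarith
    have "2 \<le> t / h" using t pos by (simp add: field_simps)
    then have half: "t / (2 * h) \<le> real n" using n2 by (simp add: field_simps)
    let ?J = "J \<inter> {..<n}"
    define W where "W k = {real k * h..<real (Suc k) * h} \<inter> C" for k
    have W_meas [measurable]: "W k \<in> sets borel" for k unfolding W_def by measurable
    have W_Icc: "W k \<subseteq> {real k * h..real (Suc k) * h}" for k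
      by (auto simp: W_def)
    have W_fin: "emeasure lborel (W k) \<noteq> \<infinity>" for k
      using W_Icc[of k] emeasure_mono[of "W k" "{real k * h..real (Suc k) * h}" lborel]
      by (auto simp: W_def top_unique emeasure_lborel_Icc_eq)
    have disj: "disjoint_family_on W ?J"
      unfolding disjoint_family_on_def
    proof (intro ballI impI)
      fix i j :: nat assume "i \<noteq> j"
      have False if "i < j" "x \<in> W i" "x \<in> W j" for i j :: nat and x
      proof -
        have "real (Suc i) * h \<le> real j * h" using that pos by (intro mult_right_mono) auto
        then show False using that by (auto simp: W_def)
      qed
      then show "W i \<inter> W j = {}" using \<open>i \<noteq> j\<close> by (metis disjoint_iff linorder_neqE_nat)
    qed
    \<comment> \<open>The \<open>n\<close> complete blocks before \<open>t\<close> make up at least half of \<open>[0,t]\<close>.\<close>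
    have "\<rho> * c / (2 * h) * t = \<rho> * (c * (t / (2 * h)))" by simp
    also have "\<dots> \<le> \<rho> * (c * real n)" using half pos by (intro mult_left_mono) auto
    also have "\<dots> \<le> \<rho> * real (card ?J)" using freq[OF \<open>n \<ge> n0\<close>] pos by simp
    also have "\<dots> = (\<Sum>k\<in>?J. \<rho>)" by simp
    also have "\<dots> \<le> (\<Sum>k\<in>?J. measure lborel (W k))"
      unfolding W_def by (intro sum_mono block) auto
    also have "\<dots> = measure lborel (\<Union>k\<in>?J. W k)"
      by (rule measure_finite_Union[symmetric]) (use disj W_fin in auto)
    also have "\<dots> \<le> measure lborel ({0..t} \<inter> C)"
    proof (rule measure_mono_fmeasurable)
      show "(\<Union>k\<in>?J. W k) \<subseteq> {0..t} \<inter> C"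
      proof
        fix x assume "x \<in> (\<Union>k\<in>?J. W k)"
        then obtain k where k: "k < n" "x \<in> W k" by auto
        have "real (Suc k) * h \<le> real n * h" using k pos by (intro mult_right_mono) auto
        moreover have "0 \<le> real k * h" using pos by simp
        ultimately show "x \<in> {0..t} \<inter> C" using k n1' by (auto simp: W_def)
      qed
      show "{0..t} \<inter> C \<in> fmeasurable lborel"
        by (rule fmeasurableI2[of "{0..t}"]) (auto simp: fmeasurable_def emeasure_lborel_Icc_eq)
    qed (auto intro!: sets.finite_UN)
    finally show ?case using t by (simp add: field_simps)
  qed
  then have "ereal (\<rho> * c / (2 * h)) \<le> lower_density C"
    unfolding lower_density_def by (rule Liminf_bounded)
  moreover have "0 < \<rho> * c / (2 * h)" using pos by simp
  ultimately show ?thesis by (metis ereal_less(2) less_le_trans)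
qed

section \<open>Flows on compact spaces and orbit integrals\<close>

definition orbit_integral :: "(real \<Rightarrow> 'w::metric_space \<Rightarrow> 'w) \<Rightarrow> ('w \<Rightarrow> real) \<Rightarrow> 'w \<Rightarrow> real \<Rightarrow> real" where
  "orbit_integral \<sigma> a \<omega> t = (LBINT s=0..ereal t. a (\<sigma> s \<omega>))"

locale compact_flow =
  fixes \<sigma> :: "real \<Rightarrow> 'w::metric_space \<Rightarrow> 'w"
  assumes compact_base: "compact (UNIV :: 'w set)"
    and flow: "continuous_flow \<sigma>"
begin

lemma flow_zero [simp]: "\<sigma> 0 \<omega> = \<omega>"
  and flow_add: "\<sigma> (s + t) \<omega> = \<sigma> s (\<sigma> t \<omega>)"
  and flow_continuous: "continuous_on UNIV (\<lambda>(t, \<omega>). \<sigma> t \<omega>)"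
  using flow by (auto simp: continuous_flow_def)

lemma flow_uminus [simp]: "\<sigma> (- t) (\<sigma> t \<omega>) = \<omega>" "\<sigma> t (\<sigma> (- t) \<omega>) = \<omega>"
  using flow_add[of "- t" t \<omega>] flow_add[of t "- t" \<omega>] by simp_all

lemma continuous_on_flow [continuous_intros]:
  assumes "continuous_on S p" "continuous_on S q"
  shows "continuous_on S (\<lambda>x. \<sigma> (p x) (q x))"
  using continuous_on_compose2[OF flow_continuous continuous_on_Pair[OF assms]] by simp

lemma flow_image: "\<sigma> t ` X = \<sigma> (- t) -` X"
proof safe
  fix x assume "\<sigma> (- t) x \<in> X"
  then show "x \<in> \<sigma> t ` X" by (intro image_eqI[of _ _ "\<sigma> (- t) x"]) auto
qed simp

lemma bounded_base: "bounded (UNIV :: 'w set)"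
  using compact_base by (rule compact_imp_bounded)

lemma continuous_bounded:
  fixes a :: "'w \<Rightarrow> real"
  assumes "continuous_on UNIV a"
  obtains K where "K > 0" "\<And>\<omega>. \<bar>a \<omega>\<bar> \<le> K"
  using compact_imp_bounded[OF compact_continuous_image[OF assms compact_base]]
  by (auto simp: bounded_pos)

lemma measure_preserving:
  assumes "invariant_measure \<sigma> m"
  shows "measure_preserving_map m (\<sigma> t)"
proof -
  have m: "prob_space m" and sets: "sets m = sets borel"
    and inv: "\<And>t B. B \<in> sets borel \<Longrightarrow> emeasure m (\<sigma> t ` B) = emeasure m B"
    using assms by (auto simp: invariant_measure_def)
  have sp: "space m = UNIV" using sets_eq_imp_space_eq[OF sets] by simp
  interpret prob_space m by fact
  have meas: "\<sigma> t \<in> measurable m m"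
    using borel_measurable_continuous_onI[of "\<sigma> t"] continuous_on_flow[of UNIV "\<lambda>_. t" "\<lambda>x. x"]
    by (simp add: measurable_cong_sets[OF sets sets] continuous_on_id)
  show ?thesis
  proof
    show "\<sigma> t \<in> measurable m m" by (rule meas)
    show "distr m m (\<sigma> t) = m"
    proof (rule measure_eqI)
      fix A assume "A \<in> sets (distr m m (\<sigma> t))"
      then have A: "A \<in> sets m" by simp
      then show "emeasure (distr m m (\<sigma> t)) A = emeasure m A"
        using inv[of A "- t"] sets by (simp add: emeasure_distr[OF meas] sp flow_image)
    qed simp
  qed
qed

context
  fixes a :: "'w \<Rightarrow> real"
  assumes a: "continuous_on UNIV a"
begin

lemma continuous_along_orbit: "continuous_on S (\<lambda>s. a (\<sigma> s \<omega>))"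
  by (rule continuous_on_compose2[OF a]) (auto intro!: continuous_intros)

lemma orbit_integral_zero [simp]: "orbit_integral \<sigma> a \<omega> 0 = 0"
  by (simp add: orbit_integral_def zero_ereal_def[symmetric])

lemma orbit_integral_deriv:
  "(orbit_integral \<sigma> a \<omega> has_real_derivative a (\<sigma> t \<omega>)) (at t)"
proof -
  define c where "c = \<bar>t\<bar> + 1"
  have c: "- c < t" "t < c" "- c \<le> 0" "0 \<le> c" unfolding c_def by linarith+
  have "((\<lambda>u. LBINT s=ereal 0..ereal u. a (\<sigma> s \<omega>)) has_vector_derivative a (\<sigma> t \<omega>)) (at t within {- c..c})"
    by (rule interval_integral_FTC2) (use c continuous_along_orbit in auto)
  then have "((\<lambda>u. LBINT s=ereal 0..ereal u. a (\<sigma> s \<omega>)) has_vector_derivative a (\<sigma> t \<omega>)) (at t)"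
    using at_within_Icc_at[of "- c" t c] c by simp
  then show ?thesis
    unfolding orbit_integral_def[abs_def] zero_ereal_def has_real_derivative_iff_has_vector_derivative .
qed

lemma orbit_integral_continuous: "continuous_on S (orbit_integral \<sigma> a \<omega>)"
  by (rule DERIV_continuous_on) (rule has_field_derivative_at_within[OF orbit_integral_deriv])

lemma orbit_integral_add:
  "orbit_integral \<sigma> a \<omega> (s + t) = orbit_integral \<sigma> a (\<sigma> t \<omega>) s + orbit_integral \<sigma> a \<omega> t"
proof -
  let ?f = "\<lambda>s. orbit_integral \<sigma> a \<omega> (s + t) - orbit_integral \<sigma> a (\<sigma> t \<omega>) s"
  have "(?f has_real_derivative 0) (at x)" for x
    by (auto intro!: derivative_eq_intros DERIV_chain2[OF orbit_integral_deriv] orbit_integral_deriv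
        simp: flow_add)
  then have "?f s = ?f 0" by (intro DERIV_isconst_all) auto
  then show ?thesis by simp
qed

lemma orbit_integral_lipschitz:
  assumes "\<And>\<omega>. \<bar>a \<omega>\<bar> \<le> K"
  shows "\<bar>orbit_integral \<sigma> a \<omega> t - orbit_integral \<sigma> a \<omega> s\<bar> \<le> K * \<bar>t - s\<bar>"
  using field_differentiable_bound[of UNIV "orbit_integral \<sigma> a \<omega>" "\<lambda>t. a (\<sigma> t \<omega>)" K t s]
    has_field_derivative_at_within[OF orbit_integral_deriv] assms by auto

text \<open>
  Fubini's theorem and invariance under each time map. Measurability of \<open>(\<omega>, s) \<mapsto> a (\<sigma> s \<omega>)\<close> for the
  product of the Borel algebras comes from rounding \<open>s\<close> down to multiples of \<open>1/n\<close>: the rounded functions depend on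
  \<open>s\<close> only through countably many values, and they converge pointwise.
\<close>
lemma orbit_integral_measurable_integral:
  assumes m: "invariant_measure \<sigma> m" and t: "0 \<le> t"
  shows "(\<lambda>\<omega>. orbit_integral \<sigma> a \<omega> t) \<in> borel_measurable m"
    and "(\<integral>\<omega>. orbit_integral \<sigma> a \<omega> t \<partial>m) = t * (\<integral>\<omega>. a \<omega> \<partial>m)"
proof -
  have pm: "prob_space m" and sets: "sets m = sets borel"
    using m by (auto simp: invariant_measure_def)
  note [measurable_cong] = sets
  interpret m: prob_space m by (rule pm)
  define N where "N = restrict_space lborel {0..t}"
  have spN: "space N = {0..t}" by (simp add: N_def)
  interpret N: finite_measure N
    by (rule finite_measureI) (use t in \<open>simp add: spN\<close>, simp add: N_def emeasure_restrict_space)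
  interpret P: pair_sigma_finite m N ..
  interpret PF: finite_measure "m \<Otimes>\<^sub>M N"
    by (rule finite_measure_pair_measure) unfold_locales
  obtain K where K: "\<And>\<omega>. \<bar>a \<omega>\<bar> \<le> K" using continuous_bounded[OF a] by metis
  define r where "r n s = real_of_int \<lfloor>real (Suc n) * s\<rfloor> / real (Suc n)" for n s
  have r_lim: "(\<lambda>n. r n s) \<longlonglongrightarrow> s" for s
  proof (rule LIM_zero_cancel, rule Lim_null_comparison)
    show "\<forall>\<^sub>F n in sequentially. norm (r n s - s) \<le> inverse (real (Suc n))"
    proof (intro always_eventually allI)
      fix n
      have "r n s - s = (of_int \<lfloor>real (Suc n) * s\<rfloor> - real (Suc n) * s) / real (Suc n)"
        by (simp add: r_def field_simps)
      moreover have "\<bar>of_int \<lfloor>real (Suc n) * s\<rfloor> - real (Suc n) * s\<bar> \<le> 1" by linarith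
      ultimately show "norm (r n s - s) \<le> inverse (real (Suc n))"
        by (simp add: abs_div divide_right_mono inverse_eq_divide)
    qed
    show "(\<lambda>n. inverse (real (Suc n))) \<longlonglongrightarrow> 0" by (rule LIMSEQ_inverse_real_of_nat)
  qed
  have meas_shift [measurable]: "(\<lambda>\<omega>. a (\<sigma> u \<omega>)) \<in> borel_measurable borel" for u
    by (rule borel_measurable_continuous_onI)
      (auto intro!: continuous_on_compose2[OF a] continuous_intros)
  have [measurable]: "(\<lambda>s. s) \<in> measurable N borel"
    unfolding N_def by (rule measurable_restrict_space1) simp
  have joint: "(\<lambda>(\<omega>, s). a (\<sigma> s \<omega>)) \<in> borel_measurable (m \<Otimes>\<^sub>M N)"
  proof (rule borel_measurable_LIMSEQ_real)
    show "(\<lambda>n. case p of (\<omega>, s) \<Rightarrow> a (\<sigma> (r n s) \<omega>)) \<longlonglongrightarrow> (case p of (\<omega>, s) \<Rightarrow> a (\<sigma> s \<omega>))" for p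
    proof -
      have "isCont (\<lambda>s. a (\<sigma> s (fst p))) (snd p)"
        using continuous_along_orbit[of UNIV "fst p"] by (simp add: continuous_on_eq_continuous_at)
      from isCont_tendsto_compose[OF this r_lim] show ?thesis by (simp add: case_prod_beta)
    qed
    fix n
    have fl: "(\<lambda>p. \<lfloor>real (Suc n) * snd p\<rfloor>) \<in> measurable (m \<Otimes>\<^sub>M N) (count_space UNIV)"
      by measurable
    have "(\<lambda>p. (\<lambda>i p. a (\<sigma> (real_of_int i / real (Suc n)) (fst p))) \<lfloor>real (Suc n) * snd p\<rfloor> p)
        \<in> borel_measurable (m \<Otimes>\<^sub>M N)"
      by (rule measurable_compose_countable[OF _ fl]) measurable
    then show "(\<lambda>p. case p of (\<omega>, s) \<Rightarrow> a (\<sigma> (r n s) \<omega>)) \<in> borel_measurable (m \<Otimes>\<^sub>M N)"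
      by (simp add: r_def case_prod_beta)
  qed
  have oi: "orbit_integral \<sigma> a \<omega> t = (\<integral>s. a (\<sigma> s \<omega>) \<partial>N)" for \<omega>
    using t by (simp add: orbit_integral_def zero_ereal_def N_def integral_restrict_space
        interval_integral_Icc set_lebesgue_integral_def del: ereal_eq_0)
  show "(\<lambda>\<omega>. orbit_integral \<sigma> a \<omega> t) \<in> borel_measurable m"
    unfolding oi using joint by (rule N.borel_measurable_lebesgue_integral)
  have int: "integrable (m \<Otimes>\<^sub>M N) (\<lambda>(\<omega>, s). a (\<sigma> s \<omega>))"
    by (rule PF.integrable_const_bound[of _ K]) (use K joint in auto)
  have "(\<integral>\<omega>. orbit_integral \<sigma> a \<omega> t \<partial>m) = (\<integral>s. (\<integral>\<omega>. a (\<sigma> s \<omega>) \<partial>m) \<partial>N)"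
    unfolding oi by (rule P.Fubini_integral[OF int, symmetric])
  also have "\<dots> = (\<integral>s. (\<integral>\<omega>. a \<omega> \<partial>m) \<partial>N)"
  proof (rule Bochner_Integration.integral_cong[OF refl])
    fix s
    have [measurable]: "a \<in> borel_measurable m"
      using meas_shift[of 0] by simp
    show "(\<integral>\<omega>. a (\<sigma> s \<omega>) \<partial>m) = (\<integral>\<omega>. a \<omega> \<partial>m)"
      by (rule measure_preserving_map.integral_compose[OF measure_preserving[OF m]]) simp
  qed
  also have "\<dots> = t * (\<integral>\<omega>. a \<omega> \<partial>m)"
    using t by (simp add: measure_def spN) (simp add: N_def emeasure_restrict_space)
  finally show "(\<integral>\<omega>. orbit_integral \<sigma> a \<omega> t \<partial>m) = t * (\<integral>\<omega>. a \<omega> \<partial>m)" .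
qed

end

end

locale minimal_base = compact_flow +
  assumes minimal: "minimal_flow \<sigma>"
begin

lemma compact_invariant_eq_UNIV:
  assumes "compact K" "K \<noteq> {}" "\<And>t. \<sigma> t ` K = K"
  shows "K = UNIV"
  using minimal assms by (auto simp: minimal_flow_def)

text \<open>
  The preimages of \<open>U\<close> under the flow cover the space, since the points that never visit \<open>U\<close> form a
  compact invariant set. Finitely many times, all in some \<open>[-N,N]\<close>, suffice for the cover; shifting by
  \<open>N\<close> turns them into times in any prescribed window of length \<open>2N\<close>.
\<close>
lemma uniform_return_time:
  assumes U: "open U" "U \<noteq> {}"
  obtains L where "L > 0" "\<forall>\<omega> s. \<exists>t\<in>{s..s + L}. \<sigma> t \<omega> \<in> U"
proof -
  define V where "V t = \<sigma> t -` U" for t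
  have V_open: "open (V t)" for t
    unfolding V_def by (rule open_vimage[OF U(1)]) (auto intro!: continuous_intros)
  have cover: "(\<Union>t. V t) = UNIV"
  proof (rule ccontr)
    assume ne: "(\<Union>t. V t) \<noteq> UNIV"
    let ?K = "- (\<Union>t. V t)"
    have "compact ?K"
      using compact_base V_open by (metis compact_Int_closed closed_Compl open_UN Int_UNIV_left)
    moreover have "\<sigma> t ` ?K = ?K" for t
    proof -
      have "\<sigma> s (\<sigma> (- t) x) \<in> U \<longleftrightarrow> \<sigma> (s - t) x \<in> U" for s x
        using flow_add[of s "- t" x] by simp
      then have "(\<exists>s. \<sigma> s (\<sigma> (- t) x) \<in> U) \<longleftrightarrow> (\<exists>s. \<sigma> s x \<in> U)" for x
        by (metis add_diff_cancel_right')
      then show ?thesis unfolding flow_image by (auto simp: V_def)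
    qed
    ultimately have "?K = UNIV" using ne by (intro compact_invariant_eq_UNIV) auto
    moreover obtain u where "u \<in> U" using U(2) by blast
    then have "u \<in> V 0" by (simp add: V_def)
    ultimately show False by blast
  qed
  obtain F where F: "finite F" "UNIV \<subseteq> (\<Union>t\<in>F. V t)"
  proof (rule compactE_image[OF compact_base, of UNIV V])
    show "\<And>t. open (V t)" by (rule V_open)
    show "UNIV \<subseteq> (\<Union>t. V t)" using cover by simp
  qed (use that in auto)
  have "bounded F" using F(1) by (rule finite_imp_bounded)
  then obtain N where N: "N > 0" "\<And>t. t \<in> F \<Longrightarrow> \<bar>t\<bar> \<le> N" by (auto simp: bounded_pos)
  have "\<exists>t\<in>{s..s + 2 * N}. \<sigma> t \<omega> \<in> U" for \<omega> s
  proof -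
    obtain t where t: "t \<in> F" "\<sigma> t (\<sigma> (s + N) \<omega>) \<in> U"
      using F(2) by (auto simp: V_def)
    then have "\<sigma> (t + (s + N)) \<omega> \<in> U" by (simp only: flow_add)
    moreover have "t + (s + N) \<in> {s..s + 2 * N}" using N(2)[OF t(1)] by (auto simp: abs_le_iff)
    ultimately show ?thesis by blast
  qed
  with that[of "2 * N"] N(1) show thesis by simp
qed

end

section \<open>Scalar equations over a flow\<close>

lemma gronwall_affine:
  fixes w :: "real \<Rightarrow> real"
  assumes t: "0 \<le> t" and C: "0 \<le> C" and e: "0 \<le> e"
    and deriv: "\<And>s. 0 \<le> s \<Longrightarrow> s \<le> t \<Longrightarrow> (w has_real_derivative w' s) (at s)"
    and bound: "\<And>s. 0 \<le> s \<Longrightarrow> s \<le> t \<Longrightarrow> w' s \<le> C * w s + e"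
  shows "w t \<le> (w 0 + e * t) * exp (C * t)"
proof -
  let ?\<phi> = "\<lambda>s. w s * exp (- (C * s)) - e * s"
  have "?\<phi> 0 \<ge> ?\<phi> t"
  proof (rule DERIV_nonpos_imp_nonincreasing[OF t], intro exI conjI)
    fix s assume s: "0 \<le> s" "s \<le> t"
    show "(?\<phi> has_real_derivative (w' s - C * w s) * exp (- (C * s)) - e) (at s)"
      using deriv[OF s] by (auto intro!: derivative_eq_intros simp: algebra_simps)
    have "(w' s - C * w s) * exp (- (C * s)) \<le> e * exp (- (C * s))"
      using bound[OF s] by (intro mult_right_mono) auto
    also have "\<dots> \<le> e * 1" using e C s by (intro mult_left_mono) auto
    finally show "(w' s - C * w s) * exp (- (C * s)) - e \<le> 0" by simp
  qed
  then have "w t * exp (- (C * t)) \<le> w 0 + e * t" by simp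
  then have "w t * exp (- (C * t)) * exp (C * t) \<le> (w 0 + e * t) * exp (C * t)"
    by (rule mult_right_mono) simp
  then show ?thesis by (simp add: mult.assoc flip: exp_add)
qed

text \<open>
  Squaring the difference makes it differentiable; the perturbation \<open>\<eta>\<close> is absorbed with
  \<open>2 r \<eta> \<le> r\<^sup>2 + \<eta>\<^sup>2\<close>. The case \<open>\<eta> = 0\<close> gives uniqueness, small \<open>\<eta>\<close> continuous dependence on the
  equation.
\<close>
lemma perturbed_solutions_close:
  fixes u v :: "real \<Rightarrow> real"
  assumes t: "0 \<le> t" and L: "0 \<le> L" and \<eta>: "0 \<le> \<eta>"
    and u: "\<And>s. 0 \<le> s \<Longrightarrow> s \<le> t \<Longrightarrow> (u has_real_derivative u' s) (at s)"
    and v: "\<And>s. 0 \<le> s \<Longrightarrow> s \<le> t \<Longrightarrow> (v has_real_derivative v' s) (at s)"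
    and bound: "\<And>s. 0 \<le> s \<Longrightarrow> s \<le> t \<Longrightarrow> \<bar>u' s - v' s\<bar> \<le> L * \<bar>u s - v s\<bar> + \<eta>"
  shows "(u t - v t)\<^sup>2 \<le> ((u 0 - v 0)\<^sup>2 + \<eta>\<^sup>2 * t) * exp ((2 * L + 1) * t)"
proof (rule gronwall_affine[OF t])
  fix s assume s: "0 \<le> s" "s \<le> t"
  show "((\<lambda>s. (u s - v s)\<^sup>2) has_real_derivative 2 * (u s - v s) * (u' s - v' s)) (at s)"
    using u[OF s] v[OF s] by (auto intro!: derivative_eq_intros)
  let ?r = "\<bar>u s - v s\<bar>"
  have "2 * (u s - v s) * (u' s - v' s) \<le> \<bar>2 * (u s - v s) * (u' s - v' s)\<bar>" by (rule abs_ge_self)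
  also have "\<dots> = 2 * ?r * \<bar>u' s - v' s\<bar>" by (simp only: abs_mult abs_numeral)
  also have "\<dots> \<le> 2 * ?r * (L * ?r + \<eta>)" by (intro mult_left_mono bound[OF s]) auto
  also have "\<dots> \<le> (2 * L + 1) * ?r\<^sup>2 + \<eta>\<^sup>2"
    using zero_le_power2[of "?r - \<eta>"] by (simp add: power2_eq_square algebra_simps)
  finally show "2 * (u s - v s) * (u' s - v' s) \<le> (2 * L + 1) * (u s - v s)\<^sup>2 + \<eta>\<^sup>2" by simp
qed (use L in auto)

locale ode_family = compact_flow \<sigma> for \<sigma> :: "real \<Rightarrow> 'w::metric_space \<Rightarrow> 'w" +
  fixes f :: "'w \<Rightarrow> real \<Rightarrow> real"
  assumes f_continuous: "continuous_on UNIV (\<lambda>(\<omega>, x). f \<omega> x)"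
    and f_lipschitz: "\<And>R. \<exists>L\<ge>0. \<forall>\<omega> x y. \<bar>x\<bar> \<le> R \<longrightarrow> \<bar>y\<bar> \<le> R \<longrightarrow> \<bar>f \<omega> x - f \<omega> y\<bar> \<le> L * \<bar>x - y\<bar>"
begin

lemma solves_unique:
  assumes u: "solves \<sigma> f \<omega> x0 J u" and v: "solves \<sigma> f \<omega> x0 J' v" and t: "t \<in> J" "t \<in> J'"
  shows "u t = v t"
proof -
  \<comment> \<open>The sign of \<open>t\<close>: for negative times the solutions are compared after reversing time.\<close>
  define e :: real where "e = (if 0 \<le> t then 1 else - 1)"
  have e: "\<bar>e\<bar> = 1" and te: "e * \<bar>t\<bar> = t" by (auto simp: e_def)
  have J: "e * s \<in> J" "e * s \<in> J'" if "0 \<le> s" "s \<le> \<bar>t\<bar>" for s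
  proof -
    have "e * s \<in> {min 0 t..max 0 t}" using that by (auto simp: e_def split: if_splits)
    moreover have "min 0 t \<in> J" "max 0 t \<in> J" "min 0 t \<in> J'" "max 0 t \<in> J'"
      using u v t by (auto simp: solves_def min_def max_def)
    ultimately show "e * s \<in> J" "e * s \<in> J'"
      using u v unfolding solves_def is_interval_1 by (meson atLeastAtMost_iff)+
  qed
  have du: "((\<lambda>s. u (e * s)) has_real_derivative f (\<sigma> (e * s) \<omega>) (u (e * s)) * e) (at s)"
    and dv: "((\<lambda>s. v (e * s)) has_real_derivative f (\<sigma> (e * s) \<omega>) (v (e * s)) * e) (at s)"
    if "0 \<le> s" "s \<le> \<bar>t\<bar>" for s
    using u v J[OF that] unfolding solves_def
    by (auto intro!: DERIV_chain2[where g = "\<lambda>s. e * s"] derivative_eq_intros)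
  have "continuous_on {0..\<bar>t\<bar>} (\<lambda>s. u (e * s))" "continuous_on {0..\<bar>t\<bar>} (\<lambda>s. v (e * s))"
    using du dv by (auto intro!: continuous_at_imp_continuous_on DERIV_isCont)
  then have "bounded ((\<lambda>s. u (e * s)) ` {0..\<bar>t\<bar>} \<union> (\<lambda>s. v (e * s)) ` {0..\<bar>t\<bar>})"
    by (simp add: compact_continuous_image compact_imp_bounded)
  then obtain R where R: "\<forall>x\<in>(\<lambda>s. u (e * s)) ` {0..\<bar>t\<bar>} \<union> (\<lambda>s. v (e * s)) ` {0..\<bar>t\<bar>}. norm x \<le> R"
    by (auto simp: bounded_iff)
  have Ru: "\<bar>u (e * s)\<bar> \<le> R" and Rv: "\<bar>v (e * s)\<bar> \<le> R" if "0 \<le> s" "s \<le> \<bar>t\<bar>" for s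
    using R that by auto
  obtain L where L: "L \<ge> 0"
    "\<And>\<omega> x y. \<bar>x\<bar> \<le> R \<Longrightarrow> \<bar>y\<bar> \<le> R \<Longrightarrow> \<bar>f \<omega> x - f \<omega> y\<bar> \<le> L * \<bar>x - y\<bar>"
    using f_lipschitz[of R] by blast
  have "(u (e * \<bar>t\<bar>) - v (e * \<bar>t\<bar>))\<^sup>2
      \<le> ((u (e * 0) - v (e * 0))\<^sup>2 + 0\<^sup>2 * \<bar>t\<bar>) * exp ((2 * L + 1) * \<bar>t\<bar>)"
  proof (rule perturbed_solutions_close)
    fix s assume s: "0 \<le> s" "s \<le> \<bar>t\<bar>"
    show "((\<lambda>s. u (e * s)) has_real_derivative f (\<sigma> (e * s) \<omega>) (u (e * s)) * e) (at s)"
      and "((\<lambda>s. v (e * s)) has_real_derivative f (\<sigma> (e * s) \<omega>) (v (e * s)) * e) (at s)"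
      using du dv s by auto
    show "\<bar>f (\<sigma> (e * s) \<omega>) (u (e * s)) * e - f (\<sigma> (e * s) \<omega>) (v (e * s)) * e\<bar>
        \<le> L * \<bar>u (e * s) - v (e * s)\<bar> + 0"
      using L(2)[OF Ru[OF s] Rv[OF s]] e by (simp flip: left_diff_distrib add: abs_mult)
  qed (use L in auto)
  then show ?thesis using u v by (simp add: te solves_def)
qed

lemma msol_eq:
  assumes "solves \<sigma> f \<omega> x0 J u" "t \<in> J"
  shows "msol \<sigma> f t \<omega> x0 = u t"
  unfolding msol_def
proof (rule the_equality)
  show "\<exists>J v. solves \<sigma> f \<omega> x0 J v \<and> t \<in> J \<and> u t = v t" using assms by blast
qed (use assms solves_unique in metis)

lemma solves_shift:
  assumes u: "solves \<sigma> f \<omega> x0 J u" and t: "t \<in> J"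
  shows "solves \<sigma> f (\<sigma> t \<omega>) (u t) {s. s + t \<in> J} (\<lambda>s. u (s + t))"
  unfolding solves_def
proof (intro conjI ballI)
  have J: "open J" "is_interval J" "0 \<in> J"
    and d: "\<And>s. s \<in> J \<Longrightarrow> (u has_real_derivative f (\<sigma> s \<omega>) (u s)) (at s)"
    using u by (auto simp: solves_def)
  have "open ((\<lambda>s. s + t) -` J)" by (intro open_vimage J) (auto intro!: continuous_intros)
  then show "open {s. s + t \<in> J}" by (simp add: vimage_def)
  show "is_interval {s. s + t \<in> J}"
    unfolding is_interval_1
  proof safe
    fix p q x assume "p + t \<in> J" "q + t \<in> J" "p \<le> x" "x \<le> q"
    then show "x + t \<in> J"
      using J(2) unfolding is_interval_1 by (meson add_right_mono)
  qed
  fix s assume "s \<in> {s. s + t \<in> J}"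
  then show "((\<lambda>s. u (s + t)) has_real_derivative f (\<sigma> s (\<sigma> t \<omega>)) (u (s + t))) (at s)"
    using DERIV_shift[of u _ s t] d[of "s + t"] by (simp add: flow_add)
qed (use t in auto)

lemma solves_msol:
  assumes "max_interval \<sigma> f \<omega> x0 = UNIV"
  shows "solves \<sigma> f \<omega> x0 UNIV (\<lambda>t. msol \<sigma> f t \<omega> x0)"
proof -
  have ex: "\<exists>J u. solves \<sigma> f \<omega> x0 J u \<and> t \<in> J" for t
    using assms unfolding max_interval_def by blast
  have "msol \<sigma> f 0 \<omega> x0 = x0"
    using ex[of 0] msol_eq by (metis solves_def)
  moreover have "((\<lambda>t. msol \<sigma> f t \<omega> x0) has_real_derivative f (\<sigma> t \<omega>) (msol \<sigma> f t \<omega> x0)) (at t)" for t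
  proof -
    obtain J u where u: "solves \<sigma> f \<omega> x0 J u" "t \<in> J" using ex by blast
    then have "(u has_real_derivative f (\<sigma> t \<omega>) (msol \<sigma> f t \<omega> x0)) (at t)" "open J"
      using msol_eq[OF u] by (auto simp: solves_def)
    then show ?thesis
      using has_field_derivative_transform_within_open[of u _ t J "\<lambda>t. msol \<sigma> f t \<omega> x0"]
        u msol_eq[OF u(1)] by simp
  qed
  ultimately show ?thesis by (simp add: solves_def)
qed

context
  fixes A :: "('w \<times> real) set"
  assumes inv: "tau_invariant \<sigma> f A"
begin

lemma inv_solves: "(\<omega>, x) \<in> A \<Longrightarrow> solves \<sigma> f \<omega> x UNIV (\<lambda>t. msol \<sigma> f t \<omega> x)"
  using inv by (intro solves_msol) (auto simp: tau_invariant_def)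

lemma inv_deriv:
  "(\<omega>, x) \<in> A \<Longrightarrow> ((\<lambda>t. msol \<sigma> f t \<omega> x) has_real_derivative f (\<sigma> t \<omega>) (msol \<sigma> f t \<omega> x)) (at t)"
  using inv_solves by (auto simp: solves_def)

lemma inv_zero: "(\<omega>, x) \<in> A \<Longrightarrow> msol \<sigma> f 0 \<omega> x = x"
  using inv_solves by (auto simp: solves_def)

lemma inv_mem: "(\<omega>, x) \<in> A \<Longrightarrow> (\<sigma> t \<omega>, msol \<sigma> f t \<omega> x) \<in> A"
  using inv by (force simp: tau_invariant_def induced_flow_def)

lemma inv_add:
  assumes "(\<omega>, x) \<in> A"
  shows "msol \<sigma> f s (\<sigma> t \<omega>) (msol \<sigma> f t \<omega> x) = msol \<sigma> f (s + t) \<omega> x"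
  by (rule msol_eq[OF solves_shift[OF inv_solves[OF assms]]]) auto

lemma inv_surj:
  assumes "(\<sigma> t \<omega>, y) \<in> A"
  obtains x where "(\<omega>, x) \<in> A" "msol \<sigma> f t \<omega> x = y"
  using that[of "msol \<sigma> f (- t) (\<sigma> t \<omega>) y"] inv_mem[OF assms, of "- t"]
    inv_add[OF assms, of t "- t"] inv_zero[OF assms] by simp

text \<open>
  If two solutions changed order they would meet by the intermediate value theorem, and flowing back
  from the meeting point would identify the initial values.
\<close>
lemma inv_order:
  assumes A: "(\<omega>, x) \<in> A" "(\<omega>, y) \<in> A" and "x < y"
  shows "msol \<sigma> f t \<omega> x < msol \<sigma> f t \<omega> y"
proof (rule ccontr)
  assume neg: "\<not> ?thesis"
  let ?d = "\<lambda>t. msol \<sigma> f t \<omega> y - msol \<sigma> f t \<omega> x"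
  have cont: "isCont ?d s" for s
    using inv_deriv[OF A(1)] inv_deriv[OF A(2)] by (intro continuous_diff DERIV_isCont)
  have d: "?d 0 > 0" "?d t \<le> 0" using neg \<open>x < y\<close> inv_zero A by auto
  have "\<exists>s. ?d s = 0"
  proof (cases "0 \<le> t")
    case True then show ?thesis using IVT2[of ?d t 0 0] d cont by auto
  next
    case False then show ?thesis using IVT[of ?d t 0 0] d cont by auto
  qed
  then obtain s where s: "msol \<sigma> f s \<omega> y = msol \<sigma> f s \<omega> x" by auto
  show False
    using inv_add[OF A(1), of "- s" s] inv_add[OF A(2), of "- s" s] inv_zero[OF A(1)]
      inv_zero[OF A(2)] s \<open>x < y\<close> by simp
qed

text \<open>
  Two orbits in \<open>A\<close> stay in a bounded set, on which the equations of nearby base points are uniformly close by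
  compactness; the rest is the Gronwall estimate.
\<close>
lemma inv_msol_continuous:
  assumes "compact A" and t: "0 \<le> t"
  shows "continuous_on A (\<lambda>(\<omega>, x). msol \<sigma> f t \<omega> x)"
  unfolding continuous_on_iff
proof (intro ballI allI impI)
  fix p and e :: real assume p: "p \<in> A" and e: "0 < e"
  obtain R where R: "\<And>\<omega> x. (\<omega>, x) \<in> A \<Longrightarrow> \<bar>x\<bar> \<le> R"
    using compact_imp_bounded[OF compact_continuous_image[OF continuous_on_snd[OF continuous_on_id] \<open>compact A\<close>]]
    unfolding bounded_iff by fastforce
  obtain L where L: "L \<ge> 0"
    "\<And>\<omega> x y. \<bar>x\<bar> \<le> R \<Longrightarrow> \<bar>y\<bar> \<le> R \<Longrightarrow> \<bar>f \<omega> x - f \<omega> y\<bar> \<le> L * \<bar>x - y\<bar>"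
    using f_lipschitz[of R] by blast
  define E where "E = exp ((2 * L + 1) * t)"
  define D where "D = (1 + t) * E"
  \<comment> \<open>With initial distance and perturbation at most \<open>k\<close>, the squared error is at most \<open>e\<^sup>2 / 2\<close>.\<close>
  define k where "k = sqrt (e\<^sup>2 / (2 * D))"
  have E: "E > 0" by (simp add: E_def)
  then have "D > 0" using t by (simp add: D_def add_pos_nonneg)
  then have "k > 0" and "k\<^sup>2 * D = e\<^sup>2 / 2" using e by (auto simp: k_def)
  then have k: "k > 0" "k\<^sup>2 * (1 + t) * E = e\<^sup>2 / 2" by (auto simp: D_def mult.assoc)
  let ?S = "{0..t} \<times> {-R..R} \<times> (UNIV :: 'w set)"
  have "uniformly_continuous_on ?S (\<lambda>(s, y, \<omega>). f (\<sigma> s \<omega>) y)"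
  proof (rule compact_uniformly_continuous)
    have "continuous_on ?S (\<lambda>q. (\<lambda>(\<omega>, y). f \<omega> y) (\<sigma> (fst q) (snd (snd q)), fst (snd q)))"
      by (rule continuous_on_compose2[OF f_continuous]) (auto intro!: continuous_intros)
    then show "continuous_on ?S (\<lambda>(s, y, \<omega>). f (\<sigma> s \<omega>) y)" by (simp add: case_prod_beta)
  qed (intro compact_Times compact_base compact_Icc)
  then obtain d where d: "d > 0" and unif: "\<And>q q'. q \<in> ?S \<Longrightarrow> q' \<in> ?S \<Longrightarrow> dist q' q < d \<Longrightarrow>
      dist ((\<lambda>(s, y, \<omega>). f (\<sigma> s \<omega>) y) q') ((\<lambda>(s, y, \<omega>). f (\<sigma> s \<omega>) y) q) < k"
    unfolding uniformly_continuous_on_def using k(1) by meson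
  show "\<exists>d>0. \<forall>p'\<in>A. dist p' p < d \<longrightarrow>
      dist (case p' of (\<omega>, x) \<Rightarrow> msol \<sigma> f t \<omega> x) (case p of (\<omega>, x) \<Rightarrow> msol \<sigma> f t \<omega> x) < e"
  proof (intro exI[of _ "min d k"] conjI ballI impI)
    fix p' assume p': "p' \<in> A" "dist p' p < min d k"
    obtain \<omega> x \<omega>' x' where pp: "p = (\<omega>, x)" "p' = (\<omega>', x')" by fastforce
    have dist: "dist \<omega>' \<omega> < d" "\<bar>x' - x\<bar> < k"
      using p'(2) dist_fst_le[of p' p] dist_snd_le[of p' p] by (auto simp: pp dist_real_def)
    have mem: "(\<omega>, x) \<in> A" "(\<omega>', x') \<in> A" using p p' pp by auto
    let ?u = "\<lambda>s. msol \<sigma> f s \<omega>' x'" and ?v = "\<lambda>s. msol \<sigma> f s \<omega> x"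
    have "(?u t - ?v t)\<^sup>2 \<le> ((?u 0 - ?v 0)\<^sup>2 + k\<^sup>2 * t) * exp ((2 * L + 1) * t)"
    proof (rule perturbed_solutions_close[OF t L(1)])
      fix s assume s: "0 \<le> s" "s \<le> t"
      have Ru: "\<bar>?u s\<bar> \<le> R" and Rv: "\<bar>?v s\<bar> \<le> R" using R inv_mem mem by blast+
      have "\<bar>f (\<sigma> s \<omega>') (?u s) - f (\<sigma> s \<omega>) (?u s)\<bar> < k"
        using unif[of "(s, ?u s, \<omega>)" "(s, ?u s, \<omega>')"] s Ru dist(1)
        by (auto simp: dist_Pair_Pair dist_real_def abs_le_iff)
      moreover have "\<bar>f (\<sigma> s \<omega>) (?u s) - f (\<sigma> s \<omega>) (?v s)\<bar> \<le> L * \<bar>?u s - ?v s\<bar>"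
        by (rule L(2)[OF Ru Rv])
      ultimately show "\<bar>f (\<sigma> s \<omega>') (?u s) - f (\<sigma> s \<omega>) (?v s)\<bar> \<le> L * \<bar>?u s - ?v s\<bar> + k"
        by linarith
    qed (use inv_deriv mem k in auto)
    also have "\<dots> = ((x' - x)\<^sup>2 + k\<^sup>2 * t) * E" using inv_zero mem by (simp add: E_def)
    also have "\<dots> \<le> (k\<^sup>2 + k\<^sup>2 * t) * E"
      using dist(2) k(1) E by (intro mult_right_mono add_right_mono) (auto simp: abs_le_square_iff[symmetric])
    also have "\<dots> = e\<^sup>2 / 2" using k(2) by (simp add: algebra_simps)
    also have "\<dots> < e\<^sup>2" using e by simp
    finally have "\<bar>?u t - ?v t\<bar> < e" using e by (intro power2_less_imp_less[of "\<bar>?u t - ?v t\<bar>" e]) simp_all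
    then show "dist (case p' of (\<omega>, x) \<Rightarrow> msol \<sigma> f t \<omega> x) (case p of (\<omega>, x) \<Rightarrow> msol \<sigma> f t \<omega> x) < e"
      by (simp add: pp dist_real_def)
  qed (use d k in auto)
qed

end

text \<open>
  The past of the solution stays in one bounded set \<open>C\<close>, so the point belongs to the image of \<open>C\<close>
  under the flow for every positive time, and these images approach the attractor, which is closed.
\<close>
lemma backward_bounded_in_attractor:
  assumes A: "global_attractor \<sigma> f A"
    and u: "solves \<sigma> f \<omega> x J u" and J: "{..0} \<subseteq> J" and R: "\<And>t. t \<le> 0 \<Longrightarrow> \<bar>u t\<bar> \<le> R"
  shows "(\<omega>, x) \<in> A"
proof (rule ccontr)
  assume notin: "(\<omega>, x) \<notin> A"
  have "closed A" using A by (auto simp: global_attractor_def compact_imp_closed)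
  then have "open (- A)" by (rule open_Compl)
  then obtain e where e: "e > 0" "\<And>q. dist q (\<omega>, x) < e \<Longrightarrow> q \<notin> A"
    using notin unfolding open_dist by blast
  let ?C = "(UNIV :: 'w set) \<times> {-R..R}"
  have "bounded ?C" by (intro bounded_Times bounded_base bounded_closed_interval)
  then have lim: "((\<lambda>t. hausdorff_semidist (induced_flow \<sigma> f t ` ?C) A) \<longlongrightarrow> 0) at_top"
    using A by (auto simp: global_attractor_def)
  have "\<forall>\<^sub>F t in at_top. ennreal e \<le> hausdorff_semidist (induced_flow \<sigma> f t ` ?C) A"
    using eventually_ge_at_top[of 0]
  proof eventually_elim
    case (elim t)
    have mt: "- t \<in> J" using J elim by auto
    have "msol \<sigma> f t (\<sigma> (- t) \<omega>) (u (- t)) = u (t + - t)"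
      by (rule msol_eq[OF solves_shift[OF u mt]]) (use u in \<open>auto simp: solves_def\<close>)
    then have "induced_flow \<sigma> f t (\<sigma> (- t) \<omega>, u (- t)) = (\<omega>, x)"
      using u by (simp add: induced_flow_def solves_def)
    moreover have "(\<sigma> (- t) \<omega>, u (- t)) \<in> ?C" using R[of "- t"] elim by (auto simp: abs_le_iff)
    ultimately have mem: "(\<omega>, x) \<in> induced_flow \<sigma> f t ` ?C" by (metis imageI)
    have "ennreal e \<le> (INF q\<in>A. ennreal (sdist (\<omega>, x) q))"
    proof (rule INF_greatest, rule ennreal_leI)
      fix q assume "q \<in> A"
      then have "e \<le> dist q (\<omega>, x)" using e(2) by (meson not_le)
      also have "\<dots> \<le> sdist (\<omega>, x) q"
        using sqrt_sum_squares_le_sum_abs[of "dist \<omega> (fst q)" "x - snd q"]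
        by (cases q) (simp add: sdist_def dist_Pair_Pair dist_real_def dist_commute power2_commute abs_minus_commute)
      finally show "e \<le> sdist (\<omega>, x) q" .
    qed
    also have "\<dots> \<le> hausdorff_semidist (induced_flow \<sigma> f t ` ?C) A"
      unfolding hausdorff_semidist_def by (rule SUP_upper2[OF mem]) simp
    finally show ?case .
  qed
  then have "ennreal e \<le> 0" by (intro tendsto_lowerbound[OF lim]) auto
  then show False using e(1) by simp
qed

end

section \<open>Attractors with interval fibers\<close>

lemma Liminf_at_top_zero:
  fixes X :: "real \<Rightarrow> real"
  assumes nonneg: "\<And>t. 0 \<le> X t" and small: "\<And>c N. 0 < c \<Longrightarrow> \<exists>t\<ge>N. X t < c"
  shows "Liminf at_top (\<lambda>t. ereal (X t)) = 0"
proof (rule antisym)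
  show "0 \<le> Liminf at_top (\<lambda>t. ereal (X t))"
    by (rule Liminf_bounded) (simp add: nonneg)
  show "Liminf at_top (\<lambda>t. ereal (X t)) \<le> 0"
  proof (rule ccontr)
    assume "\<not> ?thesis"
    then obtain c where c: "0 < ereal c" "ereal c < Liminf at_top (\<lambda>t. ereal (X t))"
      using ereal_dense2 not_le by metis
    then have "\<forall>\<^sub>F t in at_top. ereal c < ereal (X t)" by (intro less_LiminfD)
    then obtain N where "\<forall>t\<ge>N. c < X t" by (auto simp: eventually_at_top_linorder)
    with small[of c N] c(1) show False by force
  qed
qed

text \<open>
  A countable description of positivity of the limes superior, from which measurability can be read off.
\<close>
lemma Limsup_at_top_pos_iff:
  fixes X :: "real \<Rightarrow> real"
  shows "0 < Limsup at_top (\<lambda>t. ereal (X t)) \<longleftrightarrow>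
    (\<exists>k::nat. \<forall>N::nat. \<exists>t\<ge>real N. 1 / real (Suc k) < X t)"
proof
  assume "0 < Limsup at_top (\<lambda>t. ereal (X t))"
  then obtain c where c: "0 < ereal c" "ereal c < Limsup at_top (\<lambda>t. ereal (X t))"
    using ereal_dense2 by metis
  obtain k where k: "1 / real (Suc k) < c"
    using reals_Archimedean[of c] c(1) by (auto simp: inverse_eq_divide)
  have "\<exists>t\<ge>real N. 1 / real (Suc k) < X t" for N
  proof (rule ccontr)
    assume "\<not> ?thesis"
    then have "\<And>t. t \<ge> real N \<Longrightarrow> X t \<le> 1 / real (Suc k)" by (simp add: not_less) 
    then have "\<forall>\<^sub>F t in at_top. ereal (X t) \<le> ereal c"
      using k by (intro eventually_at_top_linorderI[of "real N"]) (force intro: order.trans)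
    then have "Limsup at_top (\<lambda>t. ereal (X t)) \<le> ereal c" by (rule Limsup_bounded)
    with c(2) show False by simp
  qed
  then show "\<exists>k::nat. \<forall>N::nat. \<exists>t\<ge>real N. 1 / real (Suc k) < X t" by blast
next
  assume "\<exists>k::nat. \<forall>N::nat. \<exists>t\<ge>real N. 1 / real (Suc k) < X t"
  then obtain k where k: "\<And>N::nat. \<exists>t\<ge>real N. 1 / real (Suc k) < X t" by blast
  show "0 < Limsup at_top (\<lambda>t. ereal (X t))"
  proof (rule ccontr)
    assume "\<not> ?thesis"
    then have "Limsup at_top (\<lambda>t. ereal (X t)) < ereal (1 / real (Suc k))"
      by (simp add: not_less) (metis ereal_less(2) le_less_trans of_nat_0_less_iff zero_less_Suc zero_less_divide_1_iff of_nat_Suc)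
    then have "\<forall>\<^sub>F t in at_top. ereal (X t) < ereal (1 / real (Suc k))" by (rule Limsup_lessD)
    then obtain N where N: "\<And>t. t \<ge> N \<Longrightarrow> X t < 1 / real (Suc k)"
      by (auto simp: eventually_at_top_linorder)
    obtain n :: nat where "N \<le> real n" using real_arch_simple by blast
    with k[of n] N show False by (meson less_asym order_trans)
  qed
qed

locale interval_attractor = minimal_base \<sigma> + ode_family \<sigma> f
  for \<sigma> :: "real \<Rightarrow> 'w::metric_space \<Rightarrow> 'w" and f +
  fixes A :: "('w \<times> real) set" and \<alpha> \<beta> :: "'w \<Rightarrow> real"
  assumes attractor: "global_attractor \<sigma> f A"
    and A_eq: "A = (SIGMA \<omega>:UNIV. {\<alpha> \<omega>..\<beta> \<omega>})"
    and pinched: "pinched A"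
begin

abbreviation x where "x \<equiv> msol \<sigma> f"

lemma A_compact: "compact A" and A_inv: "tau_invariant \<sigma> f A"
  using attractor by (auto simp: global_attractor_def)

lemma A_iff: "(\<omega>, y) \<in> A \<longleftrightarrow> \<alpha> \<omega> \<le> y \<and> y \<le> \<beta> \<omega>"
  by (auto simp: A_eq)

lemma fiber_eq: "fiber A \<omega> = {\<alpha> \<omega>..\<beta> \<omega>}"
  by (auto simp: fiber_def A_iff)

lemma invariant_projects_onto_base:
  assumes "tau_invariant \<sigma> f K" "compact K" "K \<noteq> {}"
  shows "fst ` K = UNIV"
proof (rule compact_invariant_eq_UNIV)
  show "compact (fst ` K)"
    using assms by (intro compact_continuous_image continuous_on_fst continuous_on_id)
  fix t
  have "induced_flow \<sigma> f t ` K = K" using assms by (auto simp: tau_invariant_def)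
  then have "fst ` K = fst ` (induced_flow \<sigma> f t ` K)" by simp
  also have "\<dots> = \<sigma> t ` (fst ` K)" by (simp add: image_image induced_flow_def)
  finally show "\<sigma> t ` (fst ` K) = fst ` K" by simp
qed (use assms in auto)

lemma alpha_le_beta: "\<alpha> \<omega> \<le> \<beta> \<omega>"
proof -
  have "A \<noteq> {}" using pinched by (auto simp: pinched_def is_singleton_def fiber_def)
  then have "\<omega> \<in> fst ` A" using invariant_projects_onto_base[OF A_inv A_compact] by simp
  then show ?thesis by (auto simp: A_iff)
qed

lemma alpha_mem: "(\<omega>, \<alpha> \<omega>) \<in> A" and beta_mem: "(\<omega>, \<beta> \<omega>) \<in> A"
  using alpha_le_beta by (auto simp: A_iff)

lemma order_mono: "(\<omega>, y) \<in> A \<Longrightarrow> (\<omega>, z) \<in> A \<Longrightarrow> y \<le> z \<Longrightarrow> x t \<omega> y \<le> x t \<omega> z"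
  using inv_order[OF A_inv] by (metis order.order_iff_strict)

lemma alpha_equilibrium: "x t \<omega> (\<alpha> \<omega>) = \<alpha> (\<sigma> t \<omega>)"
proof -
  obtain y where y: "(\<omega>, y) \<in> A" "x t \<omega> y = \<alpha> (\<sigma> t \<omega>)"
    using inv_surj[OF A_inv alpha_mem] by blast
  then have "x t \<omega> (\<alpha> \<omega>) \<le> \<alpha> (\<sigma> t \<omega>)" using order_mono[OF alpha_mem y(1), of t] y(1) unfolding A_iff by simp
  then show ?thesis using inv_mem[OF A_inv alpha_mem, of t \<omega>] unfolding A_iff by simp
qed

lemma beta_equilibrium: "x t \<omega> (\<beta> \<omega>) = \<beta> (\<sigma> t \<omega>)"
proof -
  obtain y where y: "(\<omega>, y) \<in> A" "x t \<omega> y = \<beta> (\<sigma> t \<omega>)"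
    using inv_surj[OF A_inv beta_mem] by blast
  then have "\<beta> (\<sigma> t \<omega>) \<le> x t \<omega> (\<beta> \<omega>)" using order_mono[OF y(1) beta_mem, of t] y(1) unfolding A_iff by simp
  then show ?thesis using inv_mem[OF A_inv beta_mem, of t \<omega>] unfolding A_iff by simp
qed

definition width where "width \<omega> = \<beta> \<omega> - \<alpha> \<omega>"

lemma width_nonneg: "0 \<le> width \<omega>" using alpha_le_beta by (simp add: width_def)

lemma width_flow: "width (\<sigma> t \<omega>) = x t \<omega> (\<beta> \<omega>) - x t \<omega> (\<alpha> \<omega>)"
  by (simp add: width_def alpha_equilibrium beta_equilibrium)

lemma gap_le_width:
  assumes "(\<omega>, y) \<in> A" "(\<omega>, z) \<in> A"
  shows "\<bar>x t \<omega> y - x t \<omega> z\<bar> \<le> width (\<sigma> t \<omega>)"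
  using inv_mem[OF A_inv assms(1), of t] inv_mem[OF A_inv assms(2), of t] by (auto simp: A_iff width_def)

lemma width_flow_pos_iff: "0 < width (\<sigma> t \<omega>) \<longleftrightarrow> 0 < width \<omega>"
proof -
  have "0 < width (\<sigma> t \<omega>)" if "0 < width \<omega>" for t \<omega>
    using inv_order[OF A_inv alpha_mem beta_mem, of \<omega> t] that by (simp add: width_def alpha_equilibrium beta_equilibrium)
  from this[of \<omega> t] this[of "\<sigma> t \<omega>" "- t"] show ?thesis by auto
qed

text \<open>
  The sets \<open>{\<alpha> \<le> c}\<close> and \<open>{c \<le> \<beta>}\<close> are projections of compact parts of the attractor: \<open>\<alpha>\<close> is lower and
  \<open>\<beta>\<close> upper semicontinuous.
\<close>
lemma alpha_measurable [measurable]: "\<alpha> \<in> borel_measurable borel"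
  and beta_measurable [measurable]: "\<beta> \<in> borel_measurable borel"
proof -
  have cl: "closed (fst ` (A \<inter> UNIV \<times> S))" if "closed S" for S
    by (intro compact_imp_closed compact_continuous_image continuous_on_fst continuous_on_id
        compact_Int_closed[OF A_compact] closed_Times closed_UNIV that)
  have "{\<omega>. \<alpha> \<omega> \<le> c} = fst ` (A \<inter> UNIV \<times> {..c})" for c
    using alpha_mem by (force simp: A_iff image_iff)
  then show "\<alpha> \<in> borel_measurable borel"
    using cl[of "{.._}"] by (simp add: borel_measurable_iff_le borel_closed)
  have "{\<omega>. c \<le> \<beta> \<omega>} = fst ` (A \<inter> UNIV \<times> {c..})" for c
    using beta_mem by (force simp: A_iff image_iff)
  then show "\<beta> \<in> borel_measurable borel"
    using cl[of "{_..}"] by (simp add: borel_measurable_iff_ge borel_closed)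
qed

lemma width_measurable [measurable]: "width \<in> borel_measurable borel"
  unfolding width_def[abs_def] by measurable

lemma open_width_less: "open {\<omega>. width \<omega> < c}"
proof -
  let ?K = "(A \<times> A) \<inter> {pq. fst (fst pq) = fst (snd pq) \<and> c \<le> snd (snd pq) - snd (fst pq)}"
  have "{\<omega>. c \<le> width \<omega>} = (\<lambda>pq. fst (fst pq)) ` ?K"
  proof safe
    fix \<omega> assume "c \<le> width \<omega>"
    then show "\<omega> \<in> (\<lambda>pq. fst (fst pq)) ` ?K"
      by (intro image_eqI[of _ _ "((\<omega>, \<alpha> \<omega>), (\<omega>, \<beta> \<omega>))"]) (auto simp: alpha_mem beta_mem width_def)
  qed (auto simp: A_iff width_def)
  moreover have "compact ?K"
    by (intro compact_Int_closed compact_Times A_compact closed_Collect_conj closed_Collect_eq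
        closed_Collect_le continuous_intros)
  then have "compact ((\<lambda>pq. fst (fst pq)) ` ?K)"
    by (intro compact_continuous_image continuous_intros)
  ultimately have "closed {\<omega>. c \<le> width \<omega>}" by (simp add: compact_imp_closed)
  moreover have "{\<omega>. width \<omega> < c} = - {\<omega>. c \<le> width \<omega>}" by auto
  ultimately show ?thesis by (simp add: open_Compl)
qed

lemma pinch_point: obtains \<omega>\<^sub>0 where "width \<omega>\<^sub>0 = 0"
proof -
  obtain \<omega> y where "{\<alpha> \<omega>..\<beta> \<omega>} = {y}"
    using pinched by (auto simp: pinched_def is_singleton_def fiber_eq)
  then have "width \<omega> = 0" by (auto simp: width_def Icc_eq_Icc[of _ _ y y, simplified])
  then show thesis by (rule that)
qed

lemma width_returns_small:
  assumes "0 < c"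
  obtains L where "L > 0" "\<forall>\<omega> s. \<exists>t\<in>{s..s + L}. width (\<sigma> t \<omega>) < c"
proof (rule uniform_return_time[OF open_width_less[of c]])
  obtain \<omega>\<^sub>0 where "width \<omega>\<^sub>0 = 0" by (rule pinch_point)
  with assms have "\<omega>\<^sub>0 \<in> {\<omega>. width \<omega> < c}" by simp
  then show "{\<omega>. width \<omega> < c} \<noteq> {}" by blast
qed (use that in auto)

text \<open>
  If the width were positive at a continuity point, it would be positive on a ball; but the orbit of a
  pinched point, along which the width vanishes, enters that ball.
\<close>
lemma width_zero_at_continuity:
  assumes "isCont \<alpha> \<omega>" "isCont \<beta> \<omega>"
  shows "width \<omega> = 0"
proof (rule ccontr)
  assume "width \<omega> \<noteq> 0"
  then have pos: "width \<omega> > 0" using width_nonneg[of \<omega>] by simp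
  have "isCont width \<omega>" unfolding width_def[abs_def] using assms by (intro continuous_intros)
  then obtain d where d: "d > 0" "\<And>\<omega>'. dist \<omega>' \<omega> < d \<Longrightarrow> dist (width \<omega>') (width \<omega>) < width \<omega>"
    using pos unfolding continuous_at_eps_delta by blast
  obtain \<omega>\<^sub>0 where z: "width \<omega>\<^sub>0 = 0" by (rule pinch_point)
  have "ball \<omega> d \<noteq> {}" using d(1) by simp
  with open_ball obtain L where "L > 0" "\<forall>\<omega>' s. \<exists>t\<in>{s..s + L}. \<sigma> t \<omega>' \<in> ball \<omega> d"
    by (rule uniform_return_time)
  then obtain t where "\<sigma> t \<omega>\<^sub>0 \<in> ball \<omega> d" by blast
  then have "dist (width (\<sigma> t \<omega>\<^sub>0)) (width \<omega>) < width \<omega>" using d(2)[of "\<sigma> t \<omega>\<^sub>0"] by (simp add: dist_commute)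
  moreover have "width (\<sigma> t \<omega>\<^sub>0) = 0"
    using width_flow_pos_iff[of t \<omega>\<^sub>0] z width_nonneg[of "\<sigma> t \<omega>\<^sub>0"] by simp
  ultimately show False by (simp add: dist_real_def width_nonneg)
qed

text \<open>
  One jump suffices. The forward orbit of \<open>p\<close> and the backward orbit of \<open>q\<close> both come within
  \<open>\<epsilon>/2\<close> of the point of the pinched fiber, after times at least \<open>T\<close>; the jump leads from one to the other.
\<close>
lemma attractor_chain_recurrent: "chain_recurrent sdist A (induced_flow \<sigma> f)"
  unfolding chain_recurrent_def
proof (intro allI impI ballI)
  fix \<epsilon> T :: real and p q assume eps: "\<epsilon> > 0" "T > 0" and p: "p \<in> A" and q: "q \<in> A"
  obtain \<omega>\<^sub>0 where z: "width \<omega>\<^sub>0 = 0" by (rule pinch_point)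
  define F where "F = fst ` (A \<inter> {p. \<epsilon> / 4 \<le> \<bar>snd p - \<alpha> \<omega>\<^sub>0\<bar>})"
  have "closed F" unfolding F_def
    by (intro compact_imp_closed compact_continuous_image compact_Int_closed A_compact
        closed_Collect_le continuous_intros)
  then have "open (ball \<omega>\<^sub>0 (\<epsilon> / 4) \<inter> - F)" by (intro open_Int open_ball open_Compl)
  moreover have "\<omega>\<^sub>0 \<notin> F" using z eps by (auto simp: F_def A_iff width_def)
  then have "ball \<omega>\<^sub>0 (\<epsilon> / 4) \<inter> - F \<noteq> {}" using eps by (metis Compl_iff IntI centre_in_ball emptyE zero_less_divide_iff zero_less_numeral)
  ultimately obtain L where L: "L > 0" "\<forall>\<omega> s. \<exists>t\<in>{s..s + L}. \<sigma> t \<omega> \<in> ball \<omega>\<^sub>0 (\<epsilon> / 4) \<inter> - F"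
    using uniform_return_time by metis
  obtain s where s: "s \<ge> T" "\<sigma> s (fst p) \<in> ball \<omega>\<^sub>0 (\<epsilon> / 4) \<inter> - F" using L(2)[rule_format, of T "fst p"] by auto
  obtain r where r: "r \<le> - T" "\<sigma> r (fst q) \<in> ball \<omega>\<^sub>0 (\<epsilon> / 4) \<inter> - F" using L(2)[rule_format, of "- T - L" "fst q"] by auto
  let ?\<tau> = "induced_flow \<sigma> f"
  have near: "dist \<omega>\<^sub>0 \<omega> < \<epsilon> / 4 \<and> \<bar>y - \<alpha> \<omega>\<^sub>0\<bar> < \<epsilon> / 4"
    if "(\<omega>, y) \<in> A" "\<omega> \<in> ball \<omega>\<^sub>0 (\<epsilon> / 4) \<inter> - F" for \<omega> y
    using that by (force simp: F_def image_iff)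
  have mem: "?\<tau> s p \<in> A" "?\<tau> r q \<in> A"
    using inv_mem[OF A_inv, of "fst p" "snd p" s] inv_mem[OF A_inv, of "fst q" "snd q" r] p q
    by (auto simp: induced_flow_def)
  have "dist \<omega>\<^sub>0 (fst (?\<tau> s p)) < \<epsilon> / 4 \<and> \<bar>snd (?\<tau> s p) - \<alpha> \<omega>\<^sub>0\<bar> < \<epsilon> / 4"
    and "dist \<omega>\<^sub>0 (fst (?\<tau> r q)) < \<epsilon> / 4 \<and> \<bar>snd (?\<tau> r q) - \<alpha> \<omega>\<^sub>0\<bar> < \<epsilon> / 4"
    using mem s(2) r(2) by (intro near; simp add: induced_flow_def)+
  then have "sdist (?\<tau> s p) (?\<tau> r q) < \<epsilon>"
    using dist_triangle3[of "fst (?\<tau> s p)" "fst (?\<tau> r q)" \<omega>\<^sub>0] unfolding sdist_def by linarith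
  moreover have "?\<tau> (- r) (?\<tau> r q) = q"
    using inv_add[OF A_inv, of "fst q" "snd q" "- r" r] inv_zero[OF A_inv, of "fst q" "snd q"] q
    by (simp add: induced_flow_def)
  ultimately show "\<exists>k\<ge>1. \<exists>ys s. ys 0 = p \<and> ys k = q \<and> (\<forall>i\<le>k. ys i \<in> A) \<and>
      (\<forall>i<k. s i \<ge> T \<and> sdist (?\<tau> (s i) (ys i)) (ys (Suc i)) < \<epsilon>)"
    using s(1) r(1) p q mem eps
    by (intro exI[of _ "2::nat"] conjI exI[of _ "\<lambda>i. if i = 0 then p else if i = 1 then ?\<tau> r q else q"]
        exI[of _ "\<lambda>i. if i = 0 then s else - r"])
      (auto simp: less_2_cases_iff sdist_def)
qed

lemma gap_liminf_zero:
  assumes "(\<omega>, y) \<in> A" "(\<omega>, z) \<in> A"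
  shows "Liminf at_top (\<lambda>t. ereal \<bar>x t \<omega> y - x t \<omega> z\<bar>) = 0"
proof (rule Liminf_at_top_zero)
  fix c N :: real assume "0 < c"
  then obtain L where "L > 0" "\<forall>\<omega> s. \<exists>t\<in>{s..s + L}. width (\<sigma> t \<omega>) < c" by (rule width_returns_small)
  then obtain t where "t \<ge> N" "width (\<sigma> t \<omega>) < c" by (meson atLeastAtMost_iff)
  then show "\<exists>t\<ge>N. \<bar>x t \<omega> y - x t \<omega> z\<bar> < c"
    using gap_le_width[OF assms, of t] by (intro exI[of _ t]) auto
qed simp

definition persistent_gap where
  "persistent_gap \<omega> y z \<longleftrightarrow> (\<exists>k::nat. \<forall>N::nat. \<exists>t\<ge>real N. 1 / real (Suc k) < x t \<omega> z - x t \<omega> y)"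

text \<open>
  The limes inferior of a gap always vanishes, so on a fiber only the limes superior matters.
\<close>
lemma li_yorke_pair_iff:
  assumes "(\<omega>, y) \<in> A" "(\<omega>, z) \<in> A" "y < z"
  shows "li_yorke_pair sdist (induced_flow \<sigma> f) (\<omega>, y) (\<omega>, z) \<longleftrightarrow> persistent_gap \<omega> y z"
    and "li_yorke_pair sdist (induced_flow \<sigma> f) (\<omega>, z) (\<omega>, y) \<longleftrightarrow> persistent_gap \<omega> y z"
proof -
  have ord: "x t \<omega> y \<le> x t \<omega> z" for t
    using order_mono[OF assms(1,2)] assms(3) by simp
  have gap: "\<bar>x t \<omega> y - x t \<omega> z\<bar> = x t \<omega> z - x t \<omega> y" "\<bar>x t \<omega> z - x t \<omega> y\<bar> = x t \<omega> z - x t \<omega> y" for t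
    using ord[of t] by simp_all
  have pg: "persistent_gap \<omega> y z \<longleftrightarrow> 0 < Limsup at_top (\<lambda>t. ereal (x t \<omega> z - x t \<omega> y))"
    unfolding persistent_gap_def Limsup_at_top_pos_iff ..
  have lim: "Liminf at_top (\<lambda>t. ereal (x t \<omega> z - x t \<omega> y)) = 0"
    using gap_liminf_zero[OF assms(1,2)] unfolding gap .
  show "li_yorke_pair sdist (induced_flow \<sigma> f) (\<omega>, y) (\<omega>, z) \<longleftrightarrow> persistent_gap \<omega> y z"
    and "li_yorke_pair sdist (induced_flow \<sigma> f) (\<omega>, z) (\<omega>, y) \<longleftrightarrow> persistent_gap \<omega> y z"
    unfolding pg li_yorke_pair_def induced_flow_def sdist_def fst_conv snd_conv dist_self add_0 gap
    by (simp_all add: lim)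
qed

lemma Omega_LY_iff:
  "\<omega> \<in> Omega_LY (induced_flow \<sigma> f) A \<longleftrightarrow>
    \<alpha> \<omega> < \<beta> \<omega> \<and> (\<forall>y z. \<alpha> \<omega> \<le> y \<and> y < z \<and> z \<le> \<beta> \<omega> \<longrightarrow> persistent_gap \<omega> y z)"
proof -
  have nondeg: "(\<exists>l r. l < r \<and> fiber A \<omega> = {l..r}) \<longleftrightarrow> \<alpha> \<omega> < \<beta> \<omega>"
    unfolding fiber_eq by (metis Icc_eq_Icc less_imp_le not_le)
  have "scrambled sdist (induced_flow \<sigma> f) ({\<omega>} \<times> fiber A \<omega>) \<longleftrightarrow>
      (\<forall>y z. \<alpha> \<omega> \<le> y \<and> y < z \<and> z \<le> \<beta> \<omega> \<longrightarrow> persistent_gap \<omega> y z)" (is "?l \<longleftrightarrow> ?r")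
  proof
    assume l: ?l
    show ?r
    proof (intro allI impI)
      fix y z assume yz: "\<alpha> \<omega> \<le> y \<and> y < z \<and> z \<le> \<beta> \<omega>"
      then have "li_yorke_pair sdist (induced_flow \<sigma> f) (\<omega>, y) (\<omega>, z)"
        using l by (auto simp: scrambled_def fiber_eq)
      then show "persistent_gap \<omega> y z" using li_yorke_pair_iff(1)[of \<omega> y z] yz by (auto simp: A_iff)
    qed
  next
    assume r: ?r
    show ?l unfolding scrambled_def
    proof (intro ballI impI)
      fix p q assume pq: "p \<in> {\<omega>} \<times> fiber A \<omega>" "q \<in> {\<omega>} \<times> fiber A \<omega>" "p \<noteq> q"
      define y z where "y = snd p" and "z = snd q"
      have yz: "p = (\<omega>, y)" "q = (\<omega>, z)" "y \<noteq> z"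
        "\<alpha> \<omega> \<le> y" "y \<le> \<beta> \<omega>" "\<alpha> \<omega> \<le> z" "z \<le> \<beta> \<omega>"
        using pq by (auto simp: fiber_eq y_def z_def)
      show "li_yorke_pair sdist (induced_flow \<sigma> f) p q"
      proof (cases "y < z")
        case True then show ?thesis using r yz li_yorke_pair_iff(1)[of \<omega> y z] by (auto simp: A_iff)
      next
        case False then show ?thesis using r yz li_yorke_pair_iff(2)[of \<omega> z y] by (auto simp: A_iff)
      qed
    qed
  qed
  then show ?thesis using nondeg by (auto simp: Omega_LY_def)
qed

lemma Omega_LY_invariant: "\<sigma> t ` Omega_LY (induced_flow \<sigma> f) A = Omega_LY (induced_flow \<sigma> f) A"
proof -
  let ?Y = "Omega_LY (induced_flow \<sigma> f) A"
  have fwd: "\<sigma> t \<omega> \<in> ?Y" if w: "\<omega> \<in> ?Y" for t \<omega>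
    unfolding Omega_LY_iff
  proof (intro conjI allI impI)
    show "\<alpha> (\<sigma> t \<omega>) < \<beta> (\<sigma> t \<omega>)"
      using width_flow_pos_iff[of t \<omega>] w by (auto simp: width_def Omega_LY_iff)
    fix y z assume yz: "\<alpha> (\<sigma> t \<omega>) \<le> y \<and> y < z \<and> z \<le> \<beta> (\<sigma> t \<omega>)"
    then have mem: "(\<sigma> t \<omega>, y) \<in> A" "(\<sigma> t \<omega>, z) \<in> A" by (auto simp: A_iff)
    obtain y' where y': "(\<omega>, y') \<in> A" "x t \<omega> y' = y" using inv_surj[OF A_inv mem(1)] by blast
    obtain z' where z': "(\<omega>, z') \<in> A" "x t \<omega> z' = z" using inv_surj[OF A_inv mem(2)] by blast
    have "y' < z'" using order_mono[OF z'(1) y'(1), of t] y' z' yz by (meson linorder_not_le)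
    then have "persistent_gap \<omega> y' z'" using w y' z' by (auto simp: Omega_LY_iff A_iff)
    then obtain k where k: "\<And>N. \<exists>s\<ge>real N. 1 / real (Suc k) < x s \<omega> z' - x s \<omega> y'"
      by (auto simp: persistent_gap_def)
    have "\<exists>s\<ge>real N. 1 / real (Suc k) < x s (\<sigma> t \<omega>) z - x s (\<sigma> t \<omega>) y" for N
    proof -
      obtain n :: nat where n: "\<bar>t\<bar> \<le> real n" using real_arch_simple by blast
      obtain s where s: "s \<ge> real (N + n)" "1 / real (Suc k) < x s \<omega> z' - x s \<omega> y'" using k by blast
      moreover have "x (s - t) (\<sigma> t \<omega>) y = x s \<omega> y'" "x (s - t) (\<sigma> t \<omega>) z = x s \<omega> z'"
        using inv_add[OF A_inv y'(1), of "s - t" t] inv_add[OF A_inv z'(1), of "s - t" t] y' z' by auto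
      ultimately show ?thesis using n by (intro exI[of _ "s - t"]) auto
    qed
    then show "persistent_gap (\<sigma> t \<omega>) y z" by (auto simp: persistent_gap_def)
  qed
  show ?thesis
  proof (intro equalityI subsetI)
    fix \<omega> assume "\<omega> \<in> ?Y"
    then show "\<omega> \<in> \<sigma> t ` ?Y" using fwd[of \<omega> "- t"] by (auto simp: flow_image)
  qed (use fwd in auto)
qed

lemma persistent_gap_mono:
  assumes gap: "persistent_gap \<omega> y' z'" and "\<alpha> \<omega> \<le> y" "y \<le> y'" "y' \<le> z'" "z' \<le> z" "z \<le> \<beta> \<omega>"
  shows "persistent_gap \<omega> y z"
proof -
  have "x t \<omega> y \<le> x t \<omega> y'" "x t \<omega> z' \<le> x t \<omega> z" for t
    using assms by (auto intro!: order_mono simp: A_iff)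
  then have "x t \<omega> z' - x t \<omega> y' \<le> x t \<omega> z - x t \<omega> y" for t by (simp add: diff_mono)
  then show ?thesis using gap unfolding persistent_gap_def by (meson less_le_trans)
qed

lemma persistent_gap_rational_times:
  assumes A: "(\<omega>, y) \<in> A" "(\<omega>, z) \<in> A"
  shows "persistent_gap \<omega> y z \<longleftrightarrow>
    (\<exists>k::nat. \<forall>N::nat. \<exists>t\<in>\<rat> \<inter> {real N..}. 1 / real (Suc k) < x t \<omega> z - x t \<omega> y)" (is "?l \<longleftrightarrow> ?r")
proof
  assume ?l
  then obtain k where k: "\<And>N. \<exists>t\<ge>real N. 1 / real (Suc k) < x t \<omega> z - x t \<omega> y"
    by (auto simp: persistent_gap_def)
  have "\<exists>t\<in>\<rat> \<inter> {real N..}. 1 / real (Suc k) < x t \<omega> z - x t \<omega> y" for N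
  proof -
    obtain t where t: "t \<ge> real N" "1 / real (Suc k) < x t \<omega> z - x t \<omega> y" using k by blast
    have "isCont (\<lambda>t. x t \<omega> z - x t \<omega> y) t"
      using inv_deriv[OF A_inv] A by (intro continuous_diff DERIV_isCont)
    then have "((\<lambda>t. x t \<omega> z - x t \<omega> y) \<longlongrightarrow> x t \<omega> z - x t \<omega> y) (at_right t)"
      unfolding isCont_def by (rule tendsto_within_subset) simp
    then have "\<forall>\<^sub>F s in at_right t. 1 / real (Suc k) < x s \<omega> z - x s \<omega> y"
      by (rule order_tendstoD) (rule t)
    then obtain b where b: "b > t" "\<And>s. t < s \<Longrightarrow> s < b \<Longrightarrow> 1 / real (Suc k) < x s \<omega> z - x s \<omega> y"
      unfolding eventually_at_right_field by blast
    obtain s where "s \<in> \<rat>" "t < s" "s < b" using Rats_dense_in_real[OF b(1)] by blast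
    then show ?thesis using b t by (intro bexI[of _ s]) auto
  qed
  then show ?r by blast
next
  assume ?r
  then show ?l unfolding persistent_gap_def by (meson IntE atLeast_iff)
qed

text \<open>
  The set must be Borel for its measure to be meaningful: a set outside the \<open>\<sigma>\<close>-algebra has measure
  \<open>0\<close> by convention. By order preservation a persistent gap stays persistent when the pair is moved apart, so it is enough
  to test rational \<open>q < r\<close>; by continuity in time, rational times are enough. Each remaining condition is
  relatively open in a closed set by continuity of the flow on the attractor.
\<close>
lemma Omega_LY_measurable: "Omega_LY (induced_flow \<sigma> f) A \<in> sets borel"
proof -
  define B where "B q = {\<omega>. (\<omega>, q) \<in> A}" for q
  have B_closed: "closed (B q)" for q
  proof -
    have "closed ((\<lambda>\<omega>. (\<omega>, q)) -` A)"
      by (intro closed_vimage compact_imp_closed[OF A_compact] continuous_intros)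
    then show ?thesis by (simp add: B_def vimage_def)
  qed
  define G where "G q r t c = {\<omega> \<in> B q \<inter> B r. c < x t \<omega> r - x t \<omega> q}" for q r t and c :: real
  have G_meas: "G q r t c \<in> sets borel" if "t \<ge> 0" for q r t c
  proof -
    have cont: "continuous_on (B q) (\<lambda>\<omega>. x t \<omega> q)" for q
    proof -
      have "continuous_on (B q) (\<lambda>\<omega>. (\<lambda>(\<omega>, y). x t \<omega> y) (\<omega>, q))"
        by (rule continuous_on_compose2[OF inv_msol_continuous[OF A_inv A_compact that]])
          (auto simp: B_def intro!: continuous_intros)
      then show ?thesis by simp
    qed
    have "continuous_on (B q \<inter> B r) (\<lambda>\<omega>. x t \<omega> r - x t \<omega> q)"
      by (intro continuous_on_diff continuous_on_subset[OF cont]) auto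
    then have "closed {\<omega> \<in> B q \<inter> B r. x t \<omega> r - x t \<omega> q \<le> c}"
      by (intro continuous_on_closed_Collect_le B_closed closed_Int continuous_on_const)
    moreover have "G q r t c = B q \<inter> B r - {\<omega> \<in> B q \<inter> B r. x t \<omega> r - x t \<omega> q \<le> c}"
      by (auto simp: G_def)
    ultimately show ?thesis using B_closed by (auto intro!: sets.Diff sets.Int borel_closed)
  qed
  define W where "W q r = - (B q \<inter> B r) \<union>
      (\<Union>k::nat. \<Inter>N::nat. \<Union>t\<in>\<rat> \<inter> {real N..}. G q r t (1 / real (Suc k)))" for q r
  have eq: "Omega_LY (induced_flow \<sigma> f) A =
      {\<omega>. \<alpha> \<omega> < \<beta> \<omega>} \<inter> (\<Inter>q\<in>\<rat>. \<Inter>r\<in>\<rat> \<inter> {q<..}. W q r)" (is "_ = _ \<inter> ?R")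
  proof (rule set_eqI)
    fix \<omega>
    have "\<omega> \<in> W q r \<longleftrightarrow> (\<alpha> \<omega> \<le> q \<longrightarrow> r \<le> \<beta> \<omega> \<longrightarrow> persistent_gap \<omega> q r)" if "q < r" for q r
    proof (cases "\<alpha> \<omega> \<le> q \<and> r \<le> \<beta> \<omega>")
      case True
      then have "(\<omega>, q) \<in> A" "(\<omega>, r) \<in> A" using that by (auto simp: A_iff)
      then show ?thesis using True by (simp add: persistent_gap_rational_times B_def G_def W_def)
    next
      case False then show ?thesis using that by (auto simp: B_def A_iff W_def)
    qed
    then have "\<omega> \<in> ?R \<longleftrightarrow> (\<forall>q\<in>\<rat>. \<forall>r\<in>\<rat>. q < r \<longrightarrow> \<alpha> \<omega> \<le> q \<longrightarrow> r \<le> \<beta> \<omega> \<longrightarrow> persistent_gap \<omega> q r)"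
      unfolding INT_iff by auto
    moreover have "(\<forall>y z. \<alpha> \<omega> \<le> y \<and> y < z \<and> z \<le> \<beta> \<omega> \<longrightarrow> persistent_gap \<omega> y z) \<longleftrightarrow>
        (\<forall>q\<in>\<rat>. \<forall>r\<in>\<rat>. q < r \<longrightarrow> \<alpha> \<omega> \<le> q \<longrightarrow> r \<le> \<beta> \<omega> \<longrightarrow> persistent_gap \<omega> q r)"
    proof (intro iffI allI impI)
      fix y z assume all: "\<forall>q\<in>\<rat>. \<forall>r\<in>\<rat>. q < r \<longrightarrow> \<alpha> \<omega> \<le> q \<longrightarrow> r \<le> \<beta> \<omega> \<longrightarrow> persistent_gap \<omega> q r"
        and yz: "\<alpha> \<omega> \<le> y \<and> y < z \<and> z \<le> \<beta> \<omega>"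
      obtain q where q: "q \<in> \<rat>" "y < q" "q < z" using Rats_dense_in_real[of y z] yz by blast
      obtain r where r: "r \<in> \<rat>" "q < r" "r < z" using Rats_dense_in_real[of q z] q by blast
      have "persistent_gap \<omega> q r" using all q r yz by auto
      then show "persistent_gap \<omega> y z" by (rule persistent_gap_mono) (use q r yz in auto)
    qed auto
    ultimately show "\<omega> \<in> Omega_LY (induced_flow \<sigma> f) A \<longleftrightarrow> \<omega> \<in> {\<omega>. \<alpha> \<omega> < \<beta> \<omega>} \<inter> ?R"
      unfolding Omega_LY_iff by blast
  qed
  have Bm: "B q \<in> sets borel" for q using B_closed by (rule borel_closed)
  have "?R \<in> sets borel"
  proof -
    have inner: "(\<Inter>N::nat. \<Union>t\<in>\<rat> \<inter> {real N..}. G q r t (1 / real (Suc k))) \<in> sets borel" for q r k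
      by (intro sets.countable_INT'' sets.countable_UN' countable_Int1 countable_rat ballI)
        (auto intro!: G_meas intro: order_trans[of 0 "real _"])
    have "W q r \<in> sets borel" for q r
      unfolding W_def using inner Bm by (auto intro!: sets.Un sets.countable_UN borel_comp sets.Int)
    then have "(\<Inter>r\<in>\<rat> \<inter> {q<..}. W q r) \<in> sets borel" for q
    proof (intro sets.countable_INT')
      show "countable (\<rat> \<inter> {q<..})" by (simp add: countable_rat)
      obtain s where "s \<in> \<rat>" "q < s" using Rats_dense_in_real[of q "q + 1"] by auto
      then show "\<rat> \<inter> {q<..} \<noteq> {}" by auto
    qed auto
    then show ?thesis
      by (intro sets.countable_INT') (auto simp: countable_rat intro: Rats_0)
  qed
  moreover have "{\<omega>. \<alpha> \<omega> < \<beta> \<omega>} \<in> sets borel" by measurable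
  ultimately show ?thesis unfolding eq by (rule sets.Int[rotated])
qed

end

section \<open>Conformal dynamics on almost every fiber\<close>

locale dissipative_attractor = interval_attractor \<sigma> f A \<alpha> \<beta>
  for \<sigma> :: "real \<Rightarrow> 'w::metric_space \<Rightarrow> 'w" and f A \<alpha> \<beta> +
  fixes a :: "'w \<Rightarrow> real"
  assumes a_continuous: "continuous_on UNIV a"
    and dissipative: "\<And>\<omega> y z. y \<le> z \<Longrightarrow> f \<omega> z - f \<omega> y \<le> a \<omega> * (z - y)"
begin

abbreviation I where "I \<equiv> orbit_integral \<sigma> a"

text \<open>
  The gap satisfies \<open>y' \<le> a y\<close> by dissipativity, and \<open>exp (- I \<omega> t)\<close> is the integrating factor of the
  corresponding linear equation.
\<close>
lemma normalized_gap_antimono: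
  assumes A: "(\<omega>, y) \<in> A" "(\<omega>, z) \<in> A" and "y \<le> z" "s \<le> t"
  shows "(x t \<omega> z - x t \<omega> y) * exp (- I \<omega> t) \<le> (x s \<omega> z - x s \<omega> y) * exp (- I \<omega> s)"
proof (rule DERIV_nonpos_imp_nonincreasing[OF \<open>s \<le> t\<close>], intro exI conjI)
  fix r
  let ?d = "f (\<sigma> r \<omega>) (x r \<omega> z) - f (\<sigma> r \<omega>) (x r \<omega> y) - a (\<sigma> r \<omega>) * (x r \<omega> z - x r \<omega> y)"
  show "((\<lambda>r. (x r \<omega> z - x r \<omega> y) * exp (- I \<omega> r)) has_real_derivative ?d * exp (- I \<omega> r)) (at r)"
    by (auto intro!: derivative_eq_intros inv_deriv[OF A_inv] A orbit_integral_deriv[OF a_continuous]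
        simp: algebra_simps)
  have "?d \<le> 0" using dissipative[OF order_mono[OF A \<open>y \<le> z\<close>, of r], of "\<sigma> r \<omega>"] by simp
  then show "?d * exp (- I \<omega> r) \<le> 0" by (simp add: mult_le_0_iff)
qed

lemma width_le:
  assumes "0 \<le> t"
  shows "width (\<sigma> t \<omega>) \<le> width \<omega> * exp (I \<omega> t)"
  using normalized_gap_antimono[OF alpha_mem beta_mem alpha_le_beta assms, of \<omega>]
  by (simp add: width_def alpha_equilibrium beta_equilibrium a_continuous exp_minus field_simps)

text \<open>
  The opposite, crude bound from the Lipschitz constant of \<open>f\<close> on the bounded range of the attractor. It
  makes \<open>ln width\<close> change by a bounded amount per unit time, as \<open>coboundary_integral_zero\<close> demands.
\<close>
lemma width_ge:
  obtains L where "\<And>\<omega>. width \<omega> * exp (- L) \<le> width (\<sigma> 1 \<omega>)"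
proof -
  obtain R where R: "\<And>\<omega> y. (\<omega>, y) \<in> A \<Longrightarrow> \<bar>y\<bar> \<le> R"
    using compact_imp_bounded[OF compact_continuous_image[OF continuous_on_snd[OF continuous_on_id] A_compact]]
    unfolding bounded_iff by fastforce
  obtain L where L: "L \<ge> 0"
    "\<And>\<omega> y z. \<bar>y\<bar> \<le> R \<Longrightarrow> \<bar>z\<bar> \<le> R \<Longrightarrow> \<bar>f \<omega> y - f \<omega> z\<bar> \<le> L * \<bar>y - z\<bar>"
    using f_lipschitz[of R] by blast
  have "width \<omega> * exp (- L) \<le> width (\<sigma> 1 \<omega>)" for \<omega>
  proof -
    let ?u = "\<lambda>t. \<beta> (\<sigma> t \<omega>)" and ?v = "\<lambda>t. \<alpha> (\<sigma> t \<omega>)"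
    have du: "(?u has_real_derivative f (\<sigma> t \<omega>) (?u t)) (at t)"
      and dv: "(?v has_real_derivative f (\<sigma> t \<omega>) (?v t)) (at t)" for t
      using inv_deriv[OF A_inv beta_mem, of \<omega> t] inv_deriv[OF A_inv alpha_mem, of \<omega> t]
      by (simp_all add: alpha_equilibrium beta_equilibrium)
    have "(?u 0 - ?v 0) * exp (L * 0) \<le> (?u 1 - ?v 1) * exp (L * 1)"
    proof (rule DERIV_nonneg_imp_nondecreasing, simp, intro exI conjI)
      fix t :: real
      let ?d = "f (\<sigma> t \<omega>) (?u t) - f (\<sigma> t \<omega>) (?v t) + L * (?u t - ?v t)"
      show "((\<lambda>t. (?u t - ?v t) * exp (L * t)) has_real_derivative ?d * exp (L * t)) (at t)"
        by (auto intro!: derivative_eq_intros du dv simp: algebra_simps)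
      have "0 \<le> ?d"
        using L(2)[OF R[OF beta_mem] R[OF alpha_mem], of "\<sigma> t \<omega>" "\<sigma> t \<omega>" "\<sigma> t \<omega>"]
          alpha_le_beta[of "\<sigma> t \<omega>"] by (simp add: abs_le_iff)
      then show "0 \<le> ?d * exp (L * t)" by simp
    qed
    then show ?thesis by (simp add: width_def exp_minus field_simps)
  qed
  then show thesis by (rule that)
qed

text \<open>
  The factor \<open>exp (I \<omega> t)\<close> is the solution operator of the linear equation \<open>y' = a y\<close>.
\<close>
definition conformal where
  "conformal \<omega> \<longleftrightarrow> (\<forall>t\<ge>0. \<forall>y z. (\<omega>, y) \<in> A \<longrightarrow> (\<omega>, z) \<in> A \<longrightarrow>
     x t \<omega> z - x t \<omega> y = (z - y) * exp (I \<omega> t))"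

text \<open>
  The normalized gaps of \<open>[\<alpha>,y]\<close>, \<open>[y,z]\<close> and \<open>[z,\<beta>]\<close> add up to that of \<open>[\<alpha>,\<beta>]\<close> and none of them
  increases; if their sum does not decrease, none of them does. The sum does not decrease up to time \<open>t\<close>
  because it has not decreased up to an integer \<open>n \<ge> t\<close>.
\<close>
lemma conformal_if_width:
  assumes eq: "\<And>n::nat. width (\<sigma> (real n) \<omega>) = width \<omega> * exp (I \<omega> (real n))"
  shows "conformal \<omega>"
  unfolding conformal_def
proof (intro allI impI)
  fix t y z assume t: "(0::real) \<le> t" and A: "(\<omega>, y) \<in> A" "(\<omega>, z) \<in> A"
  define Z where "Z t y z = (x t \<omega> z - x t \<omega> y) * exp (- I \<omega> t)" for t y z
  have anti: "Z t y z \<le> Z s y z" if "(\<omega>, y) \<in> A" "(\<omega>, z) \<in> A" "y \<le> z" "s \<le> t" for s t y z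
    unfolding Z_def using that by (rule normalized_gap_antimono)
  have Z0: "Z 0 y z = z - y" if "(\<omega>, y) \<in> A" "(\<omega>, z) \<in> A" for y z
    using inv_zero[OF A_inv] that by (simp add: Z_def a_continuous)
  obtain n :: nat where n: "t \<le> real n" using real_arch_simple by blast
  have "Z (real n) (\<alpha> \<omega>) (\<beta> \<omega>) = width \<omega>"
    using eq[of n] by (simp add: Z_def width_flow[symmetric] exp_minus)
  then have total: "width \<omega> \<le> Z t (\<alpha> \<omega>) (\<beta> \<omega>)"
    using anti[OF alpha_mem beta_mem alpha_le_beta n] by simp
  have *: "x t \<omega> z - x t \<omega> y = (z - y) * exp (I \<omega> t)"
    if A: "(\<omega>, y) \<in> A" "(\<omega>, z) \<in> A" and "y \<le> z" for y z
  proof -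
    have "Z t (\<alpha> \<omega>) (\<beta> \<omega>) = Z t (\<alpha> \<omega>) y + Z t y z + Z t z (\<beta> \<omega>)"
      by (simp add: Z_def algebra_simps)
    moreover have "Z t (\<alpha> \<omega>) y \<le> y - \<alpha> \<omega>" "Z t y z \<le> z - y" "Z t z (\<beta> \<omega>) \<le> \<beta> \<omega> - z"
      using anti[OF alpha_mem A(1) _ t] anti[OF A \<open>y \<le> z\<close> t] anti[OF A(2) beta_mem _ t]
        Z0[OF alpha_mem A(1)] Z0[OF A] Z0[OF A(2) beta_mem] A by (auto simp: A_iff)
    ultimately have "Z t y z = z - y" using total by (simp add: width_def)
    then show ?thesis by (simp add: Z_def exp_minus field_simps)
  qed
  show "x t \<omega> z - x t \<omega> y = (z - y) * exp (I \<omega> t)"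
    using *[OF A] *[OF A(2,1)] by (cases "y \<le> z") (auto simp: algebra_simps)
qed

text \<open>
  The set \<open>K\<close> has, on the side given by the sign \<open>sg\<close>, a margin \<open>\<delta>\<close> in which \<open>f\<close> is affine with slope
  \<open>a\<close>. If \<open>I \<omega>\<close> is bounded above on the negative half line, then a solution in \<open>K\<close> plus a small multiple
  of \<open>exp (I \<omega> t)\<close> solves the same equation and is bounded in the past, hence belongs to the
  attractor together with the original solution.
\<close>
lemma width_pos_if_bounded_primitive:
  assumes K: "tau_invariant \<sigma> f K" "compact K" "K \<noteq> {}"
    and sg: "\<bar>sg\<bar> = 1" and \<delta>: "\<delta> > 0"
    and linear: "\<And>\<omega> y c. (\<omega>, y) \<in> K \<Longrightarrow> 0 \<le> c \<Longrightarrow> c \<le> \<delta> \<Longrightarrow>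
      f \<omega> (y + sg * c) = f \<omega> y + a \<omega> * (sg * c)"
    and bdd: "bdd_above (I \<omega> ` {t. t \<le> 0})"
  shows "0 < width \<omega>"
proof -
  obtain y where y: "(\<omega>, y) \<in> K" using invariant_projects_onto_base[OF K] by force
  obtain R where R: "\<And>\<omega> y. (\<omega>, y) \<in> K \<Longrightarrow> \<bar>y\<bar> \<le> R"
    using compact_imp_bounded[OF compact_continuous_image[OF continuous_on_snd[OF continuous_on_id] K(2)]]
    unfolding bounded_iff by fastforce
  obtain B where B: "\<And>t. t \<le> 0 \<Longrightarrow> I \<omega> t \<le> B" using bdd unfolding bdd_above_def by blast
  obtain C where C: "C > 0" "\<And>\<omega>. \<bar>a \<omega>\<bar> \<le> C" using continuous_bounded[OF a_continuous] by blast
  have I_le: "I \<omega> t \<le> B + C" if "t < 1" for t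
  proof (cases "t \<le> 0")
    case True then show ?thesis using B[OF True] C(1) by simp
  next
    case False
    have "\<bar>I \<omega> t - I \<omega> 0\<bar> \<le> C * \<bar>t - 0\<bar>"
      by (rule orbit_integral_lipschitz[OF a_continuous]) (rule C)
    also have "\<dots> \<le> C * 1" using False that C(1) by (intro mult_left_mono) auto
    finally show ?thesis using B[of 0] by (simp add: a_continuous abs_le_iff)
  qed
  \<comment> \<open>The bound is needed on \<open>t < 1\<close>, because a solution must be defined on an open interval around \<open>0\<close>.\<close>
  define c where "c = \<delta> * exp (- (B + C))"
  have c: "c > 0" using \<delta> by (simp add: c_def)
  have cI: "c * exp (I \<omega> t) \<le> \<delta>" if "t < 1" for t
  proof -
    have "c * exp (I \<omega> t) = \<delta> * exp (I \<omega> t - (B + C))" by (simp add: c_def mult.assoc algebra_simps flip: exp_add)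
    also have "\<dots> \<le> \<delta> * 1" using I_le[OF that] \<delta> by (intro mult_left_mono) auto
    finally show ?thesis by simp
  qed
  let ?u = "\<lambda>k t. x t \<omega> y + sg * (k * (c * exp (I \<omega> t)))"
  have mem: "(\<omega>, y + sg * (k * c)) \<in> A" if k: "0 \<le> k" "k \<le> 1" for k
  proof (rule backward_bounded_in_attractor[OF attractor])
    have kc: "0 \<le> k * (c * exp (I \<omega> t))" "k * (c * exp (I \<omega> t)) \<le> c * exp (I \<omega> t)" for t
      using k c by (auto intro: mult_left_le_one_le)
    show "solves \<sigma> f \<omega> (y + sg * (k * c)) {..<1} (?u k)"
      unfolding solves_def
    proof (intro conjI ballI)
      show "?u k 0 = y + sg * (k * c)" using inv_zero[OF K(1) y] by (simp add: a_continuous)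
      fix t :: real assume "t \<in> {..<1}"
      then have t: "t < 1" by simp
      have "f (\<sigma> t \<omega>) (?u k t) = f (\<sigma> t \<omega>) (x t \<omega> y) + a (\<sigma> t \<omega>) * (sg * (k * (c * exp (I \<omega> t))))"
        by (rule linear[OF inv_mem[OF K(1) y]]) (use kc[of t] cI[OF t] in auto)
      then show "(?u k has_real_derivative f (\<sigma> t \<omega>) (?u k t)) (at t)"
        by (auto intro!: derivative_eq_intros inv_deriv[OF K(1) y] orbit_integral_deriv[OF a_continuous])
    qed (auto simp: is_interval_1)
    fix t :: real assume t: "t \<le> 0"
    have "\<bar>?u k t\<bar> \<le> \<bar>x t \<omega> y\<bar> + \<bar>sg * (k * (c * exp (I \<omega> t)))\<bar>" by (rule abs_triangle_ineq)
    also have "\<bar>sg * (k * (c * exp (I \<omega> t)))\<bar> = k * (c * exp (I \<omega> t))" 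
      using sg k c by (simp add: abs_mult)
    also have "\<bar>x t \<omega> y\<bar> + k * (c * exp (I \<omega> t)) \<le> R + \<delta>"
      using R[OF inv_mem[OF K(1) y, of t]] kc(2)[of t] cI[of t] t by simp
    finally show "\<bar>?u k t\<bar> \<le> R + \<delta>" .
  qed auto
  have "y \<in> {\<alpha> \<omega>..\<beta> \<omega>}" "y + sg * c \<in> {\<alpha> \<omega>..\<beta> \<omega>}"
    using mem[of 0] mem[of 1] by (auto simp: A_iff)
  moreover have "sg = 1 \<or> sg = - 1" using sg by linarith
  ultimately show ?thesis using c by (auto simp: width_def)
qed

definition recurrent_width where
  "recurrent_width \<rho> h \<omega> \<longleftrightarrow> (\<exists>c>0. \<exists>n0. \<forall>n\<ge>n0.
     c * real n \<le> real (card ({k. \<rho> * width \<omega> \<le> width (\<sigma> (real k * h) \<omega>)} \<inter> {..<n})))"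

context
  fixes m :: "'w measure"
  assumes m: "invariant_measure \<sigma> m" and a_mean: "(\<integral>\<omega>. a \<omega> \<partial>m) = 0"
    and width_pos: "AE \<omega> in m. 0 < width \<omega>"
begin

lemma sets_m [measurable_cong]: "sets m = sets borel"
  using m by (auto simp: invariant_measure_def)

text \<open>
  By \<open>width_le\<close> the coboundary of \<open>ln width\<close> is at most \<open>I \<omega> 1\<close>; both have mean zero, so they are equal
  almost everywhere.
\<close>
lemma AE_width_step: "AE \<omega> in m. width (\<sigma> 1 \<omega>) = width \<omega> * exp (I \<omega> 1)"
proof -
  interpret measure_preserving_map m "\<sigma> 1" by (rule measure_preserving[OF m])
  obtain L where L: "\<And>\<omega>. width \<omega> * exp (- L) \<le> width (\<sigma> 1 \<omega>)" by (rule width_ge) blast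
  obtain C where C: "C > 0" "\<And>\<omega>. \<bar>a \<omega>\<bar> \<le> C" using continuous_bounded[OF a_continuous] by blast
  have I_C: "\<bar>I \<omega> 1\<bar> \<le> C" for \<omega>
    using orbit_integral_lipschitz[OF a_continuous C(2), of \<omega> 1 0] by (simp add: a_continuous)
  define D where "D \<omega> = ln (width \<omega>)" for \<omega>
  have [measurable]: "D \<in> borel_measurable m" unfolding D_def by measurable
  have step: "- L \<le> D (\<sigma> 1 \<omega>) - D \<omega> \<and> D (\<sigma> 1 \<omega>) - D \<omega> \<le> I \<omega> 1" if pos: "0 < width \<omega>" for \<omega>
  proof -
    have pos1: "0 < width (\<sigma> 1 \<omega>)" using pos by (simp add: width_flow_pos_iff)
    have "ln (width \<omega> * exp (- L)) \<le> D (\<sigma> 1 \<omega>)"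
      using L[of \<omega>] pos pos1 unfolding D_def by (subst ln_le_cancel_iff) auto
    moreover have "D (\<sigma> 1 \<omega>) \<le> ln (width \<omega> * exp (I \<omega> 1))"
      using width_le[of 1 \<omega>] pos pos1 unfolding D_def by (subst ln_le_cancel_iff) auto
    ultimately show ?thesis using pos by (simp add: ln_mult D_def)
  qed
  have bound: "\<bar>D (\<sigma> 1 \<omega>) - D \<omega>\<bar> \<le> max C \<bar>L\<bar>" for \<omega>
  proof (cases "0 < width \<omega>")
    case True then show ?thesis using step[OF True] I_C[of \<omega>] by linarith
  next
    case False
    then have "width \<omega> = 0" "width (\<sigma> 1 \<omega>) = 0"
      using width_nonneg[of \<omega>] width_nonneg[of "\<sigma> 1 \<omega>"] width_flow_pos_iff[of 1 \<omega>] by auto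
    then show ?thesis by (simp add: D_def C(1) less_imp_le)
  qed
  note [measurable] = orbit_integral_measurable_integral(1)[OF a_continuous m zero_le_one]
  have int_I: "integrable m (\<lambda>\<omega>. I \<omega> 1)"
    by (rule integrable_const_bound[of _ C]) (use I_C in auto)
  have int_D: "integrable m (\<lambda>\<omega>. D (\<sigma> 1 \<omega>) - D \<omega>)"
    by (rule integrable_const_bound[of _ "max C \<bar>L\<bar>"]) (use bound in auto)
  have "(\<integral>\<omega>. I \<omega> 1 - (D (\<sigma> 1 \<omega>) - D \<omega>) \<partial>m) = 0"
    using Bochner_Integration.integral_diff[OF int_I int_D] a_mean
      coboundary_integral_zero[of D "max C \<bar>L\<bar>"] bound
      orbit_integral_measurable_integral(2)[OF a_continuous m, of 1] by simp
  then have "AE \<omega> in m. I \<omega> 1 - (D (\<sigma> 1 \<omega>) - D \<omega>) = 0"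
    by (subst (asm) integral_nonneg_eq_0_iff_AE)
      (use int_I int_D width_pos step in \<open>auto elim!: eventually_mono\<close>)
  with width_pos show ?thesis
  proof eventually_elim
    case (elim \<omega>)
    then have "width (\<sigma> 1 \<omega>) = exp (D \<omega> + I \<omega> 1)"
      by (simp add: D_def width_flow_pos_iff)
    then show ?case using elim by (simp add: exp_add D_def)
  qed
qed

lemma AE_conformal: "AE \<omega> in m. conformal \<omega>"
proof -
  have "AE \<omega> in m. width (\<sigma> 1 (\<sigma> (real n) \<omega>)) = width (\<sigma> (real n) \<omega>) * exp (I (\<sigma> (real n) \<omega>) 1)" for n
    by (rule measure_preserving_map.AE_compose[OF measure_preserving[OF m] AE_width_step])
  then have "AE \<omega> in m. \<forall>n. width (\<sigma> 1 (\<sigma> (real n) \<omega>)) = width (\<sigma> (real n) \<omega>) * exp (I (\<sigma> (real n) \<omega>) 1)"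
    by (simp add: AE_all_countable)
  then show ?thesis
  proof eventually_elim
    case (elim \<omega>)
    have "width (\<sigma> (real n) \<omega>) = width \<omega> * exp (I \<omega> (real n))" for n
    proof (induction n)
      case (Suc n)
      have "\<sigma> (real (Suc n)) \<omega> = \<sigma> 1 (\<sigma> (real n) \<omega>)"
        using flow_add[of 1 "real n" \<omega>] by (simp add: add.commute)
      moreover have "I \<omega> (real (Suc n)) = I (\<sigma> (real n) \<omega>) 1 + I \<omega> (real n)"
        using orbit_integral_add[OF a_continuous, of \<omega> 1 "real n"] by (simp add: add.commute)
      ultimately show ?case using elim Suc by (simp add: exp_add)
    qed (simp add: a_continuous)
    then show ?case by (rule conformal_if_width)
  qed
qed

text \<open>
  Apply the recurrence theorem to all sets \<open>{q \<le> width}\<close> with \<open>q\<close> rational, and pick for each \<open>\<omega>\<close> some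
  \<open>q\<close> between \<open>\<rho> * width \<omega>\<close> and \<open>width \<omega>\<close>.
\<close>
lemma AE_recurrent_width:
  assumes \<rho>: "\<rho> < 1"
  shows "AE \<omega> in m. recurrent_width \<rho> h \<omega>"
proof -
  interpret measure_preserving_map m "\<sigma> h" by (rule measure_preserving[OF m])
  have pow: "(\<sigma> h ^^ k) \<omega> = \<sigma> (real k * h) \<omega>" for k \<omega>
  proof (induction k)
    case (Suc k)
    then show ?case using flow_add[of h "real k * h" \<omega>] by (simp add: algebra_simps)
  qed simp
  have "AE \<omega> in m. \<forall>q\<in>\<rat>. q \<le> width \<omega> \<longrightarrow> (\<exists>c>0. \<exists>n0. \<forall>n\<ge>n0.
      c * real n \<le> real (card ({k. q \<le> width (\<sigma> (real k * h) \<omega>)} \<inter> {..<n})))"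
  proof (subst AE_ball_countable[OF countable_rat], intro ballI)
    fix q
    have "{\<omega>. q \<le> width \<omega>} \<in> sets m" by (simp add: sets_m) 
    from visits_positive_frequency[OF this]
    show "AE \<omega> in m. q \<le> width \<omega> \<longrightarrow> (\<exists>c>0. \<exists>n0. \<forall>n\<ge>n0.
        c * real n \<le> real (card ({k. q \<le> width (\<sigma> (real k * h) \<omega>)} \<inter> {..<n})))"
      by (simp add: pow)
  qed
  with width_pos show ?thesis
  proof eventually_elim
    case (elim \<omega>)
    have "\<rho> * width \<omega> < width \<omega>" using \<rho> elim by simp
    then obtain q where q: "q \<in> \<rat>" "\<rho> * width \<omega> < q" "q < width \<omega>"
      using Rats_dense_in_real by blast
    then obtain c n0 where c: "c > 0" and freq: "\<And>n. n \<ge> n0 \<Longrightarrow>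
        c * real n \<le> real (card ({k. q \<le> width (\<sigma> (real k * h) \<omega>)} \<inter> {..<n}))"
      using elim by (meson less_imp_le)
    have "c * real n \<le> real (card ({k. \<rho> * width \<omega> \<le> width (\<sigma> (real k * h) \<omega>)} \<inter> {..<n}))"
      if "n \<ge> n0" for n
    proof -
      have "card ({k. q \<le> width (\<sigma> (real k * h) \<omega>)} \<inter> {..<n})
          \<le> card ({k. \<rho> * width \<omega> \<le> width (\<sigma> (real k * h) \<omega>)} \<inter> {..<n})"
        using q by (intro card_mono) auto
      then show ?thesis using freq[OF that] by linarith
    qed
    then show ?case using c by (auto simp: recurrent_width_def)
  qed
qed

end

lemma conformal_width:
  assumes "conformal \<omega>" "0 \<le> t"
  shows "width (\<sigma> t \<omega>) = width \<omega> * exp (I \<omega> t)"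
  using assms(1)[unfolded conformal_def, rule_format, OF assms(2) alpha_mem beta_mem]
  unfolding width_flow by (simp add: width_def)

lemma conformal_in_Omega_LY:
  assumes conf: "conformal \<omega>" and pos: "0 < width \<omega>" and rec: "recurrent_width (1/2) 1 \<omega>"
  shows "\<omega> \<in> Omega_LY (induced_flow \<sigma> f) A"
  unfolding Omega_LY_iff
proof (intro conjI allI impI)
  show "\<alpha> \<omega> < \<beta> \<omega>" using pos by (simp add: width_def)
  fix y z assume yz: "\<alpha> \<omega> \<le> y \<and> y < z \<and> z \<le> \<beta> \<omega>"
  then have A: "(\<omega>, y) \<in> A" "(\<omega>, z) \<in> A" by (auto simp: A_iff)
  define J where "J = {k::nat. 1/2 * width \<omega> \<le> width (\<sigma> (real k * 1) \<omega>)}"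
  obtain c n0 where c: "c > 0" and freq: "\<forall>n\<ge>n0. c * real n \<le> real (card (J \<inter> {..<n}))"
    using rec unfolding recurrent_width_def J_def by blast
  have unbounded: "\<exists>k\<in>J. N \<le> k" for N
  proof (rule ccontr)
    assume "\<not> ?thesis"
    then have sub: "J \<inter> {..<n} \<subseteq> {..<N}" for n by (auto simp: not_le)
    obtain k :: nat where k: "real N < real k * c" using reals_Archimedean3[OF c] by blast
    have "c * real (max k n0) \<le> real (card (J \<inter> {..<max k n0}))" using freq by simp
    also have "\<dots> \<le> real N" using card_mono[OF _ sub[of "max k n0"]] by simp
    finally have "c * real (max k n0) \<le> real N" .
    moreover have "c * real k \<le> c * real (max k n0)" using c by simp
    ultimately show False using k by (simp add: mult.commute)
  qed
  obtain j where j: "1 / real (Suc j) < (z - y) / 2"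
    using reals_Archimedean[of "(z - y) / 2"] yz by (auto simp: inverse_eq_divide)
  show "persistent_gap \<omega> y z"
    unfolding persistent_gap_def
  proof (intro exI[of _ j] allI)
    fix N :: nat
    obtain k where k: "k \<in> J" "N \<le> k" using unbounded by blast
    have "1/2 * width \<omega> \<le> width \<omega> * exp (I \<omega> (real k))"
      using k(1) conformal_width[OF conf, of "real k"] by (simp add: J_def)
    then have "1/2 \<le> exp (I \<omega> (real k))" using pos by simp
    then have "(z - y) * (1/2) \<le> (z - y) * exp (I \<omega> (real k))" using yz by (intro mult_left_mono) auto
    also have "\<dots> = x (real k) \<omega> z - x (real k) \<omega> y" using conf A by (simp add: conformal_def)
    finally show "\<exists>t\<ge>real N. 1 / real (Suc j) < x t \<omega> z - x t \<omega> y"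
      using j k(2) by (intro exI[of _ "real k"]) auto
  qed
qed

lemma I_forward_bound:
  assumes C: "\<And>\<omega>. \<bar>a \<omega>\<bar> \<le> C" and "s \<le> t" "t \<le> s + h"
  shows "\<bar>I \<omega> t - I \<omega> s\<bar> \<le> C * h"
proof -
  have "0 \<le> C" using C[of \<omega>] by linarith
  have "\<bar>I \<omega> t - I \<omega> s\<bar> \<le> C * \<bar>t - s\<bar>" by (rule orbit_integral_lipschitz[OF a_continuous C])
  also have "\<dots> \<le> C * h" using assms(2,3) \<open>0 \<le> C\<close> by (intro mult_left_mono) auto
  finally show ?thesis .
qed

text \<open>
  Over a conformal point the times in question are those with \<open>exp (I \<omega> t) \<le> \<epsilon>\<close>. Within every window of
  length \<open>L\<close> the width drops below \<open>\<epsilon> exp(-K) width \<omega>\<close>, and as \<open>I\<close> grows by at most \<open>K\<close> per unit time,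
  the following unit of time consists of contraction times.
\<close>
lemma contraction_times:
  assumes conf: "conformal \<omega>" and pos: "0 < width \<omega>" and \<epsilon>: "0 < \<epsilon>"
  defines "C \<equiv> {t. t \<ge> 0 \<and> (\<forall>y z. (\<omega>, y) \<in> A \<and> (\<omega>, z) \<in> A \<longrightarrow>
    \<bar>x t \<omega> z - x t \<omega> y\<bar> \<le> \<epsilon> * \<bar>z - y\<bar>)}"
  shows "lower_density C > 0" "relatively_dense C"
proof -
  have C_eq: "C = {t. 0 \<le> t \<and> exp (I \<omega> t) \<le> \<epsilon>}"
  proof (rule set_eqI)
    fix t
    show "t \<in> C \<longleftrightarrow> t \<in> {t. 0 \<le> t \<and> exp (I \<omega> t) \<le> \<epsilon>}"
    proof (cases "0 \<le> t")
      case True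
      have gap: "\<bar>x t \<omega> z - x t \<omega> y\<bar> = exp (I \<omega> t) * \<bar>z - y\<bar>" if "(\<omega>, y) \<in> A" "(\<omega>, z) \<in> A" for y z
        using conf that True by (simp add: conformal_def abs_mult)
      show ?thesis
      proof
        assume "t \<in> C"
        then have "\<forall>y z. (\<omega>, y) \<in> A \<and> (\<omega>, z) \<in> A \<longrightarrow> \<bar>x t \<omega> z - x t \<omega> y\<bar> \<le> \<epsilon> * \<bar>z - y\<bar>"
          by (simp add: C_def)
        from this[rule_format, OF conjI[OF alpha_mem beta_mem]]
        have "exp (I \<omega> t) * \<bar>\<beta> \<omega> - \<alpha> \<omega>\<bar> \<le> \<epsilon> * \<bar>\<beta> \<omega> - \<alpha> \<omega>\<bar>"
          unfolding gap[OF alpha_mem beta_mem] .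
        then show "t \<in> {t. 0 \<le> t \<and> exp (I \<omega> t) \<le> \<epsilon>}" using pos True by (simp add: width_def)
      next
        assume "t \<in> {t. 0 \<le> t \<and> exp (I \<omega> t) \<le> \<epsilon>}"
        then have le: "exp (I \<omega> t) \<le> \<epsilon>" by simp
        show "t \<in> C" unfolding C_def
        proof (intro CollectI conjI allI impI True)
          fix y z assume "(\<omega>, y) \<in> A \<and> (\<omega>, z) \<in> A"
          then have "\<bar>x t \<omega> z - x t \<omega> y\<bar> = exp (I \<omega> t) * \<bar>z - y\<bar>" using gap by blast
          with le show "\<bar>x t \<omega> z - x t \<omega> y\<bar> \<le> \<epsilon> * \<bar>z - y\<bar>" by (simp add: mult_right_mono)
        qed
      qed
    qed (simp add: C_def)
  qed
  obtain K where K: "K > 0" "\<And>\<omega>. \<bar>a \<omega>\<bar> \<le> K" using continuous_bounded[OF a_continuous] by blast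
  have "0 < \<epsilon> * exp (- K) * width \<omega>" using \<epsilon> pos by simp
  then obtain L where L: "L > 0" "\<forall>\<omega>' s. \<exists>t\<in>{s..s + L}. width (\<sigma> t \<omega>') < \<epsilon> * exp (- K) * width \<omega>"
    by (rule width_returns_small)
  have visit: "\<exists>t\<in>{s..s + L}. {t..t + 1} \<subseteq> C" if s: "0 \<le> s" for s
  proof -
    obtain t where t: "t \<in> {s..s + L}" "width (\<sigma> t \<omega>) < \<epsilon> * exp (- K) * width \<omega>" using L(2) by blast
    have t0: "0 \<le> t" using t s by simp
    have "exp (I \<omega> t) < \<epsilon> * exp (- K)"
      using t(2) pos unfolding conformal_width[OF conf t0] by (simp add: mult.commute)
    then have small: "exp (I \<omega> t) * exp K < \<epsilon>" by (simp add: exp_minus field_simps)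
    have "r \<in> C" if r: "r \<in> {t..t + 1}" for r
    proof -
      have "I \<omega> r \<le> I \<omega> t + K" using I_forward_bound[OF K(2), of t r 1 \<omega>] r by simp
      then have "exp (I \<omega> r) \<le> exp (I \<omega> t) * exp K" by (simp flip: exp_add)
      then show ?thesis using small r t0 by (simp add: C_eq)
    qed
    then show ?thesis using t(1) by blast
  qed
  have "closed C"
    unfolding C_eq using orbit_integral_continuous[OF a_continuous, of UNIV \<omega>]
    by (intro closed_Collect_conj closed_Collect_le continuous_intros) auto
  then have meas: "C \<in> sets borel" by (rule borel_closed)
  have fm: "{p..<q} \<inter> C \<in> fmeasurable lborel" for p q :: real
    by (rule fmeasurableI2[of "{p..q}"]) (use meas in \<open>auto simp: fmeasurable_def emeasure_lborel_Icc_eq\<close>)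
  show "lower_density C > 0"
  proof (rule lower_density_pos_if_blocks[OF meas, where h = "L + 1" and \<rho> = 1 and c = 1 and J = UNIV])
    fix n :: nat
    let ?s = "real n * (L + 1)"
    have "0 \<le> ?s" using L(1) by simp
    then obtain t where t: "t \<in> {?s..?s + L}" "{t..t + 1} \<subseteq> C" using visit by blast
    have "{t..<t + 1} \<subseteq> {?s..<real (Suc n) * (L + 1)} \<inter> C"
    proof
      fix r assume r: "r \<in> {t..<t + 1}"
      then have "r \<in> C" using t(2) by (intro subsetD[OF t(2)]) simp
      moreover have "real (Suc n) * (L + 1) = ?s + L + 1" by (simp add: algebra_simps)
      ultimately show "r \<in> {?s..<real (Suc n) * (L + 1)} \<inter> C" using t(1) r by auto
    qed
    then have "measure lborel {t..<t + 1} \<le> measure lborel ({?s..<real (Suc n) * (L + 1)} \<inter> C)"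
    proof (rule measure_mono_fmeasurable)
      show "{?s..<real (Suc n) * (L + 1)} \<inter> C \<in> fmeasurable lborel"
        by (rule fm)
    qed simp
    then show "1 \<le> measure lborel ({?s..<real (Suc n) * (L + 1)} \<inter> C)" by simp
  qed (use L(1) in auto)
  show "relatively_dense C"
    unfolding relatively_dense_def
  proof (intro exI[of _ L] conjI allI impI L(1))
    fix s :: real assume "0 \<le> s"
    then obtain t where "t \<in> {s..s + L}" "{t..t + 1} \<subseteq> C" using visit by blast
    moreover from this(2) have "t \<in> C" by (rule subsetD) simp
    ultimately show "{s..s + L} \<inter> C \<noteq> {}" by blast
  qed
qed

text \<open>
  The loss \<open>1 - \<epsilon> = \<rho>\<^sup>2\<close> is split evenly: one factor \<open>\<rho>\<close> for the recurrence of the width at the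
  times \<open>k h\<close>, the other for the drift during the following block. The length \<open>h = - ln \<rho> / K\<close> is chosen so
  that \<open>exp I\<close> loses at most the factor \<open>exp (- K h) = \<rho>\<close> within a block.
\<close>
lemma near_isometry_times:
  assumes conf: "conformal \<omega>" and pos: "0 < width \<omega>" and \<epsilon>: "0 < \<epsilon>" "\<epsilon> < 1"
    and K: "K > 0" "\<And>\<omega>. \<bar>a \<omega>\<bar> \<le> K"
    and rec: "recurrent_width (sqrt (1 - \<epsilon>)) (- ln (sqrt (1 - \<epsilon>)) / K) \<omega>"
  shows "lower_density {t. t \<ge> 0 \<and> (\<forall>y z. (\<omega>, y) \<in> A \<and> (\<omega>, z) \<in> A \<longrightarrow>
    \<bar>x t \<omega> z - x t \<omega> y\<bar> \<ge> (1 - \<epsilon>) * \<bar>z - y\<bar>)} > 0"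
proof -
  define C where "C = {t. 0 \<le> t \<and> 1 - \<epsilon> \<le> exp (I \<omega> t)}"
  define \<rho> where "\<rho> = sqrt (1 - \<epsilon>)"
  define h where "h = - ln \<rho> / K"
  have \<rho>: "0 < \<rho>" "\<rho> < 1" "\<rho> * \<rho> = 1 - \<epsilon>" using \<epsilon> by (auto simp: \<rho>_def)
  have h: "0 < h" using divide_neg_pos[of "ln \<rho>" K] \<rho> K(1) by (simp add: h_def)
  have exp_h: "exp (- (K * h)) = \<rho>" using K(1) \<rho>(1) by (simp add: h_def)
  define J where "J = {k::nat. \<rho> * width \<omega> \<le> width (\<sigma> (real k * h) \<omega>)}"
  obtain c n0 where c: "c > 0" and freq: "\<forall>n\<ge>n0. c * real n \<le> real (card (J \<inter> {..<n}))"
    using rec unfolding recurrent_width_def J_def \<rho>_def[symmetric] h_def[symmetric] by blast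
  have "closed C"
    unfolding C_def using orbit_integral_continuous[OF a_continuous, of UNIV \<omega>]
    by (intro closed_Collect_conj closed_Collect_le continuous_intros) auto
  then have meas: "C \<in> sets borel" by (rule borel_closed)
  have "lower_density C > 0"
  proof (rule lower_density_pos_if_blocks[OF meas h h c _ freq[rule_format]])
    fix n assume n: "n \<in> J"
    let ?s = "real n * h"
    have s: "0 \<le> ?s" using h by simp
    have \<rho>_le: "\<rho> \<le> exp (I \<omega> ?s)"
      using n pos unfolding J_def mem_Collect_eq conformal_width[OF conf s] by (simp add: mult.commute)
    have "{?s..<real (Suc n) * h} \<subseteq> C"
    proof
      fix t assume t: "t \<in> {?s..<real (Suc n) * h}"
      have "I \<omega> ?s - K * h \<le> I \<omega> t"
        using I_forward_bound[OF K(2), of ?s t h \<omega>] t by (auto simp: algebra_simps abs_le_iff)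
      then have "exp (I \<omega> ?s) * exp (- (K * h)) \<le> exp (I \<omega> t)" by (simp flip: exp_add)
      moreover have "\<rho> * \<rho> \<le> exp (I \<omega> ?s) * exp (- (K * h))"
        unfolding exp_h using \<rho>_le \<rho>(1) by (intro mult_right_mono) auto
      ultimately show "t \<in> C" using t s \<rho>(3) by (simp add: C_def)
    qed
    then have "{?s..<real (Suc n) * h} \<inter> C = {?s..<real (Suc n) * h}" by blast
    then show "h \<le> measure lborel ({?s..<real (Suc n) * h} \<inter> C)" using h by (simp add: algebra_simps)
  qed
  moreover have "C = {t. t \<ge> 0 \<and> (\<forall>y z. (\<omega>, y) \<in> A \<and> (\<omega>, z) \<in> A \<longrightarrow>
    \<bar>x t \<omega> z - x t \<omega> y\<bar> \<ge> (1 - \<epsilon>) * \<bar>z - y\<bar>)}" (is "_ = ?S")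
  proof (rule set_eqI)
    fix t
    show "t \<in> C \<longleftrightarrow> t \<in> ?S"
    proof (cases "0 \<le> t")
      case True
      have gap: "\<bar>x t \<omega> z - x t \<omega> y\<bar> = exp (I \<omega> t) * \<bar>z - y\<bar>" if "(\<omega>, y) \<in> A" "(\<omega>, z) \<in> A" for y z
        using conf that True by (simp add: conformal_def abs_mult)
      show ?thesis
      proof
        assume "t \<in> ?S"
        then have "\<forall>y z. (\<omega>, y) \<in> A \<and> (\<omega>, z) \<in> A \<longrightarrow> (1 - \<epsilon>) * \<bar>z - y\<bar> \<le> \<bar>x t \<omega> z - x t \<omega> y\<bar>"
          by simp
        from this[rule_format, OF conjI[OF alpha_mem beta_mem]]
        have "(1 - \<epsilon>) * \<bar>\<beta> \<omega> - \<alpha> \<omega>\<bar> \<le> exp (I \<omega> t) * \<bar>\<beta> \<omega> - \<alpha> \<omega>\<bar>"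
          unfolding gap[OF alpha_mem beta_mem] .
        then show "t \<in> C" using pos True by (simp add: width_def C_def)
      next
        assume "t \<in> C"
        then have le: "1 - \<epsilon> \<le> exp (I \<omega> t)" by (simp add: C_def)
        show "t \<in> ?S"
        proof (intro CollectI conjI allI impI True)
          fix y z assume "(\<omega>, y) \<in> A \<and> (\<omega>, z) \<in> A"
          then have "\<bar>x t \<omega> z - x t \<omega> y\<bar> = exp (I \<omega> t) * \<bar>z - y\<bar>" using gap by blast
          with le show "(1 - \<epsilon>) * \<bar>z - y\<bar> \<le> \<bar>x t \<omega> z - x t \<omega> y\<bar>" by (simp add: mult_right_mono)
        qed
      qed
    qed (simp add: C_def)
  qed
  ultimately show ?thesis by simp
qed

end

section \<open>Chaos and times of contraction and near isometry\<close>

text \<open>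
  Only the points of \<open>[r1,r2]\<close> need an argument: a positive derivative there would make \<open>g\<close> nonzero at
  nearby points of the interval, on the right or, at \<open>r2\<close>, on the left.
\<close>
lemma antimono_if_flat_and_decreasing:
  fixes g g' :: "real \<Rightarrow> real"
  assumes "r1 < r2"
    and deriv: "\<And>x. (g has_real_derivative g' x) (at x)"
    and flat: "\<And>x. r1 \<le> x \<Longrightarrow> x \<le> r2 \<Longrightarrow> g x = 0"
    and decreasing: "\<And>x. x \<notin> {r1..r2} \<Longrightarrow> g' x < 0"
    and "y \<le> z"
  shows "g z \<le> g y"
proof -
  have nonpos: "g' x \<le> 0" for x
  proof (rule ccontr)
    assume pos: "\<not> g' x \<le> 0"
    then have x: "r1 \<le> x" "x \<le> r2" using decreasing[of x] by auto
    show False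
    proof (cases "x < r2")
      case True
      obtain d where d: "d > 0" "\<And>h. 0 < h \<Longrightarrow> h < d \<Longrightarrow> g x < g (x + h)"
        using DERIV_pos_inc_right[OF deriv, of x] pos by auto
      define h where "h = min (d / 2) (r2 - x)"
      have "0 < h" "h < d" "x + h \<le> r2" using d(1) True by (auto simp: h_def)
      then show False using d(2)[of h] flat[of x] flat[of "x + h"] x by simp
    next
      case False
      obtain d where d: "d > 0" "\<And>h. 0 < h \<Longrightarrow> h < d \<Longrightarrow> g (x - h) < g x"
        using DERIV_pos_inc_left[OF deriv, of x] pos by auto
      define h where "h = min (d / 2) (x - r1)"
      have "0 < h" "h < d" "r1 \<le> x - h" using d(1) False x \<open>r1 < r2\<close> by (auto simp: h_def)
      then show False using d(2)[of h] flat[of x] flat[of "x - h"] x by simp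
    qed
  qed
  show ?thesis
    by (rule DERIV_nonpos_imp_nonincreasing[OF \<open>y \<le> z\<close>]) (use deriv nonpos in blast)
qed

lemma lipschitz_if_continuous_derivative:
  fixes g g' :: "'w::metric_space \<Rightarrow> real \<Rightarrow> real"
  assumes compact_base: "compact (UNIV :: 'w set)"
    and deriv: "\<And>\<omega> x. (g \<omega> has_real_derivative g' \<omega> x) (at x)"
    and cont: "continuous_on UNIV (\<lambda>(\<omega>, x). g' \<omega> x)"
  shows "\<exists>L\<ge>0. \<forall>\<omega> x y. \<bar>x\<bar> \<le> R \<longrightarrow> \<bar>y\<bar> \<le> R \<longrightarrow> \<bar>g \<omega> x - g \<omega> y\<bar> \<le> L * \<bar>x - y\<bar>"
proof -
  have "compact ((\<lambda>(\<omega>, x). g' \<omega> x) ` (UNIV \<times> {-R..R}))"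
    by (rule compact_continuous_image[OF continuous_on_subset[OF cont subset_UNIV]])
      (intro compact_Times compact_base compact_Icc)
  from compact_imp_bounded[OF this] obtain L where L: "L > 0" "\<And>\<omega> v. v \<in> {-R..R} \<Longrightarrow> \<bar>g' \<omega> v\<bar> \<le> L"
    unfolding bounded_pos by force
  have "\<bar>g \<omega> x - g \<omega> y\<bar> \<le> L * \<bar>x - y\<bar>" if "\<bar>x\<bar> \<le> R" "\<bar>y\<bar> \<le> R" for \<omega> x y
  proof -
    have "norm (g \<omega> x - g \<omega> y) \<le> L * norm (x - y)"
    proof (rule field_differentiable_bound)
      show "convex {-R..R}" by simp
      fix v assume "v \<in> {-R..R}"
      then show "norm (g' \<omega> v) \<le> L" using L(2) by simp
      show "(g \<omega> has_field_derivative g' \<omega> v) (at v within {-R..R})"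
        by (rule has_field_derivative_at_within[OF deriv])
    qed (use that in auto)
    then show ?thesis by simp
  qed
  then show ?thesis using L(1) by (intro exI[of _ L]) auto
qed

theorem theorem3p14:
  fixes \<sigma> :: "real \<Rightarrow> 'w::metric_space \<Rightarrow> 'w"
    and a b :: "'w \<Rightarrow> real"
    and g gx f :: "'w \<Rightarrow> real \<Rightarrow> real"
    and r1 r2 :: real
    and \<tau> :: "real \<Rightarrow> 'w \<times> real \<Rightarrow> 'w \<times> real"
    and A M :: "('w \<times> real) set"
    and \<alpha> \<beta> :: "'w \<Rightarrow> real"
    and \<Omega>c :: "'w set"
    and m :: "'w measure"
  assumes "compact (UNIV :: 'w set)"
    and "continuous_flow \<sigma>" and "minimal_flow \<sigma>"
    and "continuous_on UNIV a" and "continuous_on UNIV b"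
    and "r1 < r2"
    and "\<And>\<omega> x. (g \<omega> has_real_derivative gx \<omega> x) (at x)"
    and "continuous_on UNIV (\<lambda>(\<omega>, x). g \<omega> x)"
    and "continuous_on UNIV (\<lambda>(\<omega>, x). gx \<omega> x)"
    and "\<And>\<omega> x. r1 \<le> x \<Longrightarrow> x \<le> r2 \<Longrightarrow> g \<omega> x = 0"
    and "\<And>\<omega> x. x < r1 \<Longrightarrow> g \<omega> x > 0"
    and "\<And>\<omega> x. x > r2 \<Longrightarrow> g \<omega> x < 0"
    and "\<And>K::real. \<forall>\<^sub>F x in at_top. \<forall>\<omega>. g \<omega> x / x < K"
    and "\<And>K::real. \<forall>\<^sub>F x in at_bot. \<forall>\<omega>. g \<omega> x / x < K"
    and "\<And>\<omega> x. x \<notin> {r1..r2} \<Longrightarrow> gx \<omega> x < 0"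
    and f_def: "f = (\<lambda>\<omega> x. a \<omega> * x + b \<omega> + g \<omega> x)"
    and tau_def: "\<tau> = induced_flow \<sigma> f"
    and "global_attractor \<sigma> f A"
    and "A = (SIGMA \<omega>:UNIV. {\<alpha> \<omega>..\<beta> \<omega>})"
    and Omega_c_def: "\<Omega>c = {\<omega>. isCont \<alpha> \<omega> \<and> isCont \<beta> \<omega>}"
    and "pinched A"
    and "tau_minimal \<sigma> f M" and "\<And>N. tau_minimal \<sigma> f N \<Longrightarrow> N = M"
    and "M \<subseteq> UNIV \<times> {r1..<r2} \<or> M \<subseteq> UNIV \<times> {r1<..r2}"
    and "Sup (sacker_sell_spectrum \<sigma> a) = 0"
    and "ergodic_measure \<sigma> m" and "a \<in> R_class \<sigma> m"
  shows "(\<Omega>c \<in> null_sets m \<and>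
          chain_recurrent sdist A \<tau> \<and>
          fiber_chaotic_in_measure \<tau> A m \<and>
          (\<forall>t. \<sigma> t ` Omega_LY \<tau> A = Omega_LY \<tau> A) \<and>
          Omega_LY \<tau> A \<subseteq> UNIV - \<Omega>c \<and>
          measure m (Omega_LY \<tau> A) = 1) \<and>
         (\<forall>\<epsilon>\<in>{0<..<1}. \<exists>\<Omega>\<epsilon> \<subseteq> Omega_LY \<tau> A. measure m \<Omega>\<epsilon> = 1 \<and>
            (\<forall>\<omega>\<in>\<Omega>\<epsilon>.
               (let C = {t. t \<ge> 0 \<and> (\<forall>x1 x2. (\<omega>, x1) \<in> A \<and> (\<omega>, x2) \<in> A \<longrightarrow>
                            \<bar>msol \<sigma> f t \<omega> x2 - msol \<sigma> f t \<omega> x1\<bar> \<le> \<epsilon> * \<bar>x2 - x1\<bar>)}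
                in lower_density C > 0 \<and> relatively_dense C) \<and>
               lower_density {t. t \<ge> 0 \<and> (\<forall>x1 x2. (\<omega>, x1) \<in> A \<and> (\<omega>, x2) \<in> A \<longrightarrow>
                            \<bar>msol \<sigma> f t \<omega> x2 - msol \<sigma> f t \<omega> x1\<bar> \<ge> (1 - \<epsilon>) * \<bar>x2 - x1\<bar>)} > 0))"
proof -
  interpret compact_flow \<sigma> by unfold_locales fact+
  note g_deriv = assms(7) and g_cont = assms(8) and gx_cont = assms(9)
  have f_split: "f \<omega> x = a \<omega> * x + b \<omega> + g \<omega> x" for \<omega> x by (simp add: f_def)
  have f_cont: "continuous_on UNIV (\<lambda>(\<omega>, x). f \<omega> x)"
  proof -
    have "continuous_on UNIV (\<lambda>p. a (fst p) * snd p + b (fst p) + (\<lambda>(\<omega>, x). g \<omega> x) p)"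
      by (intro continuous_intros continuous_on_compose2[OF assms(4)]
          continuous_on_compose2[OF assms(5)] g_cont) auto
    then show ?thesis by (simp add: f_split case_prod_beta)
  qed
  have f_lip: "\<exists>L\<ge>0. \<forall>\<omega> x y. \<bar>x\<bar> \<le> R \<longrightarrow> \<bar>y\<bar> \<le> R \<longrightarrow> \<bar>f \<omega> x - f \<omega> y\<bar> \<le> L * \<bar>x - y\<bar>" for R
  proof (rule lipschitz_if_continuous_derivative[OF compact_base])
    show "(f \<omega> has_real_derivative a \<omega> + gx \<omega> x) (at x)" for \<omega> x
      unfolding f_def by (auto intro!: derivative_eq_intros g_deriv)
    have "continuous_on UNIV (\<lambda>p. a (fst p) + (\<lambda>(\<omega>, x). gx \<omega> x) p)"
      by (intro continuous_intros continuous_on_compose2[OF assms(4)] gx_cont) auto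
    then show "continuous_on UNIV (\<lambda>(\<omega>, x). a \<omega> + gx \<omega> x)" by (simp add: case_prod_beta)
  qed
  have f_diss: "f \<omega> z - f \<omega> y \<le> a \<omega> * (z - y)" if "y \<le> z" for \<omega> y z
    using antimono_if_flat_and_decreasing[OF \<open>r1 < r2\<close> g_deriv assms(10) assms(15) that, of \<omega>]
    by (simp add: f_split algebra_simps)
  interpret dissipative_attractor \<sigma> f A \<alpha> \<beta> a
    by unfold_locales (fact f_cont f_lip f_diss | fact)+
  have m: "invariant_measure \<sigma> m"
    using \<open>ergodic_measure \<sigma> m\<close> by (simp add: ergodic_measure_def)
  then have sets_m: "sets m = sets borel" and "prob_space m" by (auto simp: invariant_measure_def)
  interpret prob_space m by fact
  have a_mean: "(\<integral>\<omega>. a \<omega> \<partial>m) = 0"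
    and bdd: "AE \<omega> in m. bdd_above (I \<omega> ` {t. t \<le> 0})"
    using \<open>a \<in> R_class \<sigma> m\<close> by (auto simp: R_class_def orbit_integral_def)
  have M: "tau_invariant \<sigma> f M" "compact M" "M \<noteq> {}"
    using \<open>tau_minimal \<sigma> f M\<close> by (auto simp: tau_minimal_def)
  \<comment> \<open>The side on which the minimal set keeps a distance from the boundary of the band.\<close>
  have "\<exists>sg \<delta>. \<bar>sg\<bar> = 1 \<and> \<delta> > 0 \<and> (\<forall>\<omega> y c. (\<omega>, y) \<in> M \<longrightarrow> 0 \<le> c \<longrightarrow> c \<le> \<delta> \<longrightarrow>
      y \<in> {r1..r2} \<and> y + sg * c \<in> {r1..r2})"
    using assms(24)
  proof
    assume sub: "M \<subseteq> UNIV \<times> {r1..<r2}"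
    obtain p where p: "p \<in> M" "\<And>q. q \<in> M \<Longrightarrow> snd q \<le> snd p"
      using continuous_attains_sup[OF M(2,3) continuous_on_snd[OF continuous_on_id]] by blast
    have "y \<in> {r1..r2} \<and> y + 1 * c \<in> {r1..r2}" if "(\<omega>, y) \<in> M" "0 \<le> c" "c \<le> r2 - snd p" for \<omega> y c
      using p(2)[OF that(1)] sub that by auto
    then show ?thesis using p(1) sub by (intro exI[of _ 1] exI[of _ "r2 - snd p"]) auto
  next
    assume sub: "M \<subseteq> UNIV \<times> {r1<..r2}"
    obtain p where p: "p \<in> M" "\<And>q. q \<in> M \<Longrightarrow> snd p \<le> snd q"
      using continuous_attains_inf[OF M(2,3) continuous_on_snd[OF continuous_on_id]] by blast
    have "y \<in> {r1..r2} \<and> y + (- 1) * c \<in> {r1..r2}" if "(\<omega>, y) \<in> M" "0 \<le> c" "c \<le> snd p - r1" for \<omega> y c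
      using p(2)[OF that(1)] sub that by auto
    then show ?thesis using p(1) sub by (intro exI[of _ "- 1"] exI[of _ "snd p - r1"]) auto
  qed
  then obtain sg \<delta> where sg: "\<bar>sg\<bar> = 1" "\<delta> > 0"
    and band: "\<forall>\<omega> y c. (\<omega>, y) \<in> M \<longrightarrow> 0 \<le> c \<longrightarrow> c \<le> \<delta> \<longrightarrow> y \<in> {r1..r2} \<and> y + sg * c \<in> {r1..r2}"
    by blast
  have linear: "f \<omega> (y + sg * c) = f \<omega> y + a \<omega> * (sg * c)"
    if "(\<omega>, y) \<in> M" "0 \<le> c" "c \<le> \<delta>" for \<omega> y c
    using band[rule_format, OF that] assms(10)[of y \<omega>] assms(10)[of "y + sg * c" \<omega>]
    by (simp add: f_split algebra_simps)
  have width_pos: "AE \<omega> in m. 0 < width \<omega>"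
    using bdd by eventually_elim (rule width_pos_if_bounded_primitive[OF M sg linear])
  note conf = AE_conformal[OF m a_mean width_pos] and rec = AE_recurrent_width[OF m a_mean width_pos]
  let ?LY = "Omega_LY \<tau> A"
  have LY: "AE \<omega> in m. \<omega> \<in> ?LY"
  proof -
    have "AE \<omega> in m. recurrent_width (1/2) 1 \<omega>" by (rule rec) simp
    with conf width_pos show ?thesis
      unfolding tau_def by eventually_elim (rule conformal_in_Omega_LY)
  qed
  have LY_sets: "?LY \<in> sets m" unfolding sets_m tau_def by (rule Omega_LY_measurable)
  have c_zero: "width \<omega> = 0" if "\<omega> \<in> \<Omega>c" for \<omega>
    using that unfolding Omega_c_def by (auto intro: width_zero_at_continuity)
  have "\<Omega>c = {\<omega>. isCont \<alpha> \<omega>} \<inter> {\<omega>. isCont \<beta> \<omega>}" by (auto simp: Omega_c_def)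
  then have c_sets: "\<Omega>c \<in> sets m" unfolding sets_m by (auto intro!: sets.Int isCont_borel)
  have c_null: "\<Omega>c \<in> null_sets m"
  proof (subst AE_iff_null_sets[OF c_sets])
    show "AE \<omega> in m. \<omega> \<notin> \<Omega>c" using width_pos by eventually_elim (use c_zero in force)
  qed
  have chaotic: "fiber_chaotic_in_measure \<tau> A m"
    unfolding fiber_chaotic_in_measure_def
  proof (intro exI[of _ ?LY] conjI ballI)
    show "measure m ?LY = 1" using LY by (subst prob_eq_1[OF LY_sets])
    fix \<omega> assume w: "\<omega> \<in> ?LY"
    let ?S = "{\<omega>} \<times> fiber A \<omega>"
    have "uncountable (fiber A \<omega>)"
      using w unfolding tau_def Omega_LY_iff fiber_eq by (simp add: uncountable_closed_interval)
    moreover have "snd ` ?S = fiber A \<omega>" by force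
    ultimately have "uncountable ?S" by (metis countable_image)
    moreover have "?S \<subseteq> A" "fst ` ?S \<subseteq> {\<omega>}" by (auto simp: fiber_def)
    moreover have "scrambled sdist \<tau> ?S" using w by (simp add: Omega_LY_def)
    ultimately show "\<exists>S\<subseteq>A. fst ` S \<subseteq> {\<omega>} \<and> uncountable S \<and> scrambled sdist \<tau> S" by blast
  qed
  have part1: "\<Omega>c \<in> null_sets m \<and> chain_recurrent sdist A \<tau> \<and> fiber_chaotic_in_measure \<tau> A m \<and>
      (\<forall>t. \<sigma> t ` ?LY = ?LY) \<and> ?LY \<subseteq> UNIV - \<Omega>c \<and> measure m ?LY = 1"
  proof (intro conjI allI)
    show "chain_recurrent sdist A \<tau>" unfolding tau_def by (rule attractor_chain_recurrent)
    show "\<sigma> t ` ?LY = ?LY" for t unfolding tau_def by (rule Omega_LY_invariant)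
    show "?LY \<subseteq> UNIV - \<Omega>c"
      using c_zero unfolding tau_def by (force simp: Omega_LY_iff width_def)
    show "measure m ?LY = 1" using LY by (subst prob_eq_1[OF LY_sets])
  qed (rule c_null chaotic)+
  obtain K where K: "K > 0" "\<And>\<omega>. \<bar>a \<omega>\<bar> \<le> K" using continuous_bounded[OF assms(4)] by blast
  have part2: "\<exists>\<Omega>\<epsilon> \<subseteq> ?LY. measure m \<Omega>\<epsilon> = 1 \<and> (\<forall>\<omega>\<in>\<Omega>\<epsilon>.
      (let C = {t. t \<ge> 0 \<and> (\<forall>x1 x2. (\<omega>, x1) \<in> A \<and> (\<omega>, x2) \<in> A \<longrightarrow>
                  \<bar>msol \<sigma> f t \<omega> x2 - msol \<sigma> f t \<omega> x1\<bar> \<le> \<epsilon> * \<bar>x2 - x1\<bar>)}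
       in lower_density C > 0 \<and> relatively_dense C) \<and>
      lower_density {t. t \<ge> 0 \<and> (\<forall>x1 x2. (\<omega>, x1) \<in> A \<and> (\<omega>, x2) \<in> A \<longrightarrow>
                  \<bar>msol \<sigma> f t \<omega> x2 - msol \<sigma> f t \<omega> x1\<bar> \<ge> (1 - \<epsilon>) * \<bar>x2 - x1\<bar>)} > 0)"
    (is "\<exists>\<Omega>\<epsilon> \<subseteq> ?LY. measure m \<Omega>\<epsilon> = 1 \<and> (\<forall>\<omega>\<in>\<Omega>\<epsilon>. ?P \<omega>)") if \<epsilon>: "\<epsilon> \<in> {0<..<1}" for \<epsilon>
  proof -
    have \<epsilon>': "0 < \<epsilon>" "\<epsilon> < 1" using \<epsilon> by auto
    have "AE \<omega> in m. recurrent_width (sqrt (1 - \<epsilon>)) (- ln (sqrt (1 - \<epsilon>)) / K) \<omega>"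
      by (rule rec) (use \<epsilon>' in simp)
    with LY conf width_pos have "AE \<omega> in m. \<omega> \<in> ?LY \<and> ?P \<omega>"
    proof eventually_elim
      case (elim \<omega>)
      then show ?case
        unfolding Let_def
        by (intro conjI contraction_times near_isometry_times[OF _ _ _ _ K]) (use \<epsilon>' in auto)
    qed
    then obtain N where N: "{\<omega> \<in> space m. \<not> (\<omega> \<in> ?LY \<and> ?P \<omega>)} \<subseteq> N" "emeasure m N = 0" "N \<in> sets m"
      by (rule AE_E)
    have "space m = UNIV" using sets_eq_imp_space_eq[OF sets_m] by simp
    then have "- N \<subseteq> ?LY" "\<forall>\<omega>\<in>- N. ?P \<omega>" and "- N = space m - N" using N(1) by blast+
    moreover have "measure m (space m - N) = 1" using prob_compl[OF N(3)] N(2) by (simp add: measure_def)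
    ultimately show ?thesis by (intro exI[of _ "- N"]) simp
  qed
  show ?thesis using part1 part2 by blast
qed

end
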